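(* Let $x_0=0$ and let $\{x_n\}_{n\in\mathbb{N}}$ be a strictly increasing sequence of positive numbers with $\lim_{n\to+\infty}x_n=+\infty$ and $\inf_{n\in\mathbb{N}}(x_n-x_{n-1})>1$. Let $C$ be the comb domain \[C=\{z\in\mathbb{C}:\mathrm{Re}\, z>-x_1\}\setminus\bigcup_{n\in\mathbb{N}\cup\{0\}}\{x_n+iy: y\in\mathbb{R},\ |y|\ge 1\},\] and set $\alpha_n=x_n-x_{n-1}$ for $n\in\mathbb{N}$. Then the Hardy number satisfies ${\rm h}(C)=+\infty$ if and only if \[\lim_{n\to+\infty}\frac{\sum_{i=1}^{n}\log\alpha_i}{\log x_n}=+\infty,\quad\text{or, equivalently,}\quad \lim_{n\to+\infty}\frac{\sum_{i=1}^{n}\log\alpha_i}{\log\sum_{i=1}^{n}\alpha_i}=+\infty.\]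
   Context: $\mathbb{N}=\{1,2,3,\dots\}$ and $\mathbb{D}$ is the open unit disk in $\mathbb{C}$. For $p>0$, the Hardy space $H^p(\mathbb{D})$ is the set of all holomorphic functions $f$ on $\mathbb{D}$ with $\sup_{0<r<1}\int_0^{2\pi}|f(re^{i\theta})|^p\,d\theta<+\infty$. If $D\ne\mathbb{C}$ is a simply connected domain and $f$ is a Riemann mapping (conformal bijection) from $\mathbb{D}$ onto $D$, the Hardy number of $D$ is ${\rm h}(D)=\sup\{p>0: f\in H^p(\mathbb{D})\}\in[1/2,+\infty]$; it does not depend on the choice of $f$. *)

theory Defs
  imports "HOL-Complex_Analysis.Complex_Analysis"
begin

definition Hardy_space :: "real \<Rightarrow> (complex \<Rightarrow> complex) set" where
  "Hardy_space p = {f. f holomorphic_on ball 0 1 \<and>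
     bdd_above ((\<lambda>r. integral {0..2 * pi} (\<lambda>\<theta>. cmod (f (of_real r * cis \<theta>)) powr p)) ` {0<..<1})}"

definition Riemann_map :: "(complex \<Rightarrow> complex) \<Rightarrow> complex set \<Rightarrow> bool" where
  "Riemann_map f D \<longleftrightarrow> f holomorphic_on ball 0 1 \<and> bij_betw f (ball 0 1) D"

lemma Riemann_map_exists:
  assumes "open D" "simply_connected D" "D \<noteq> {}" "D \<noteq> UNIV"
  shows "\<exists>f. Riemann_map f D"
proof -
  from assms Riemann_mapping_theorem[of D] obtain f g where
    "g holomorphic_on ball 0 1"
    and "\<forall>z\<in>D. f z \<in> ball 0 1 \<and> g (f z) = z"
    and "\<forall>z\<in>ball 0 1. g z \<in> D \<and> f (g z) = z"
    by blast
  then have "Riemann_map g D"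
    unfolding Riemann_map_def by (auto intro!: bij_betw_byWitness[where f' = f])
  then show ?thesis by blast
qed

text \<open>Meaningful when \<open>D\<close> is a nonempty simply connected open set other than the whole
  plane; there the value does not depend on the Riemann mapping that is chosen.\<close>

definition hardy_number :: "complex set \<Rightarrow> ereal" where
  "hardy_number D = (let f = (SOME f. Riemann_map f D)
     in Sup (ereal ` {p. p > 0 \<and> f \<in> Hardy_space p}))"

definition comb_domain :: "(nat \<Rightarrow> real) \<Rightarrow> complex set" where
  "comb_domain x = {z. Re z > - x 1} - (\<Union>n. {Complex (x n) y | y. \<bar>y\<bar> \<ge> 1})"

end

theory Submission
  imports Defs "HOL-Probability.Sinc_Integral"
begin

text \<open>
  A Riemann map \<open>f\<close> onto the comb is tested against the quantity
  \<open>S n = (\<Sum>i\<le>n. ln (\<alpha> i))\<close>, which is, up to constants, the hyperbolic distance from \<open>0\<close> to \<open>x n\<close>: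
  both estimates of that distance go through the function \<open>h\<close> with derivative
  \<open>1 / (1 + dist t (range x))\<close>, whose increment over the \<open>n\<close>-th room is comparable to \<open>ln (\<alpha> n)\<close>.

  If \<open>S n / ln (x n) \<rightarrow> \<infinity>\<close>, then a logarithmic distance \<open>- ln (1 - \<bar>z\<bar>)\<close> only allows \<open>\<bar>f z\<bar>\<close> to be
  \<open>O((1 - \<bar>z\<bar>) powr (- \<epsilon>))\<close> for every \<open>\<epsilon>\<close>. For an injective \<open>f\<close> this puts \<open>f\<close> in every Hardy space:
  by the arithmetic-geometric mean inequality the radial derivative of \<open>f ^ k\<close> is at most
  \<open>(1 - \<rho>) powr (- 1/2)\<close> plus a multiple of \<open>\<bar>f'\<bar>\<^sup>2 \<psi>(f)\<close> with \<open>\<psi>\<close> integrable over the plane, and the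
  latter has a finite area integral by the change of variables \<open>w = f z\<close>.
  Conversely, a function in the Hardy space of exponent \<open>k\<close> satisfies
  \<open>\<bar>f z\<bar> ^ k = O(1 / (1 - \<bar>z\<bar>))\<close>, and evaluating this at the preimage of \<open>x n\<close> bounds \<open>k * ln (x n)\<close> by
  a multiple of \<open>S n\<close>.
\<close>

section \<open>Schwarz--Pick estimates\<close>

text \<open>Disc automorphisms \<open>N\<close> and \<open>M\<close> carry 0 to \<open>z\<close> and
  \<open>F z\<close> to 0, so the Schwarz lemma bounds the derivative of
  \<open>M \<circ> (F \<circ> N)\<close> at 0; the chain rule turns this into the claim.\<close>

lemma Schwarz_Pick:
  assumes hol: "F holomorphic_on ball 0 1"
    and lt1: "\<And>z. z \<in> ball 0 1 \<Longrightarrow> cmod (F z) < 1"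
    and z: "z \<in> ball 0 1"
  shows "cmod (deriv F z) * (1 - (cmod z)\<^sup>2) \<le> 1 - (cmod (F z))\<^sup>2"
proof -
  define M where "M = Moebius_function 0 (F z)"
  define N where "N = Moebius_function 0 (- z)"
  have zlt: "cmod z < 1" and Fz: "cmod (F z) < 1" using z lt1 by auto
  have pos: "1 - (cmod z)\<^sup>2 > 0" "1 - (cmod (F z))\<^sup>2 > 0"
    using zlt Fz by (auto simp: power_less_one_iff abs_square_less_1)
  have sq: "w * cnj w = of_real ((cmod w)\<^sup>2)" for w
    by (rule complex_norm_square[symmetric])
  have M_hol: "M holomorphic_on ball 0 1" and N_hol: "N holomorphic_on ball 0 1"
    unfolding M_def N_def using zlt Fz by (auto intro!: Moebius_function_holomorphic)
  have N_ball: "N w \<in> ball 0 1" if "w \<in> ball 0 1" for w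
    using that zlt unfolding N_def by (auto intro!: Moebius_function_norm_lt_1)
  have N0: "N 0 = z" by (simp add: N_def Moebius_function_def)
  have "(N has_field_derivative (1 - z * cnj z)) (at 0)"
    unfolding N_def Moebius_function_simple
    by (auto intro!: derivative_eq_intros simp: algebra_simps)
  then have dN: "(N has_field_derivative of_real (1 - (cmod z)\<^sup>2)) (at 0)"
    by (simp add: sq)
  have nz: "1 - cnj (F z) * F z \<noteq> 0"
    using pos(2) sq[of "F z"] by (metis eq_iff_diff_eq_0 less_irrefl mult.commute of_real_1 of_real_eq_iff)
  have "(M has_field_derivative 1 / (1 - cnj (F z) * F z)) (at (F z))"
    unfolding M_def Moebius_function_simple
    using nz by (auto intro!: derivative_eq_intros simp: divide_simps)
  then have dM: "(M has_field_derivative of_real (1 / (1 - (cmod (F z))\<^sup>2))) (at (F z))"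
    by (simp add: sq mult.commute[of "cnj (F z)"])
  have dF: "(F has_field_derivative deriv F z) (at (N 0))"
    using hol z N0 by (simp add: holomorphic_derivI)
  have dM': "(M has_field_derivative of_real (1 / (1 - (cmod (F z))\<^sup>2))) (at (F (N 0)))"
    using dM N0 by simp
  have "((F \<circ> N) has_field_derivative deriv F z * of_real (1 - (cmod z)\<^sup>2)) (at 0)"
    using DERIV_chain[OF dF dN] .
  then have "((M \<circ> (F \<circ> N)) has_field_derivative
      of_real (1 / (1 - (cmod (F z))\<^sup>2)) * (deriv F z * of_real (1 - (cmod z)\<^sup>2))) (at 0)"
    using DERIV_chain[of M _ "F \<circ> N" 0 _ UNIV] dM' by (metis comp_apply)
  then have D: "deriv (M \<circ> (F \<circ> N)) 0 =
      of_real (1 / (1 - (cmod (F z))\<^sup>2)) * (deriv F z * of_real (1 - (cmod z)\<^sup>2))"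
    by (rule DERIV_imp_deriv)
  have FN: "F \<circ> N holomorphic_on ball 0 1"
    using holomorphic_on_compose_gen[OF N_hol hol] N_ball by blast
  have hol': "M \<circ> (F \<circ> N) holomorphic_on ball 0 1"
    by (rule holomorphic_on_compose_gen[OF FN M_hol]) (use N_ball lt1 in auto)
  have "cmod (deriv (M \<circ> (F \<circ> N)) 0) \<le> 1"
  proof (rule Schwarz_Lemma(2)[OF hol', of 0])
    show "(M \<circ> (F \<circ> N)) 0 = 0" by (simp add: N0 M_def Moebius_function_eq_zero)
    show "cmod ((M \<circ> (F \<circ> N)) w) < 1" if "cmod w < 1" for w
      unfolding M_def o_def
      by (intro Moebius_function_norm_lt_1 Fz lt1 N_ball) (use that in auto)
  qed auto
  then have "\<bar>1 - (cmod z)\<^sup>2\<bar> * cmod (deriv F z) / \<bar>1 - (cmod (F z))\<^sup>2\<bar> \<le> 1"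
    unfolding D norm_mult norm_of_real by (simp add: mult.commute)
  then show ?thesis using pos by (simp add: field_simps)
qed

text \<open>The Cayley transform u -> (u - 1) / (u + 1) sends the right half plane into the unit
  disc, where \<open>Schwarz_Pick\<close> applies; the identity \<open>id\<close> evaluates the
  resulting defect from 1.\<close>

lemma Schwarz_Pick_halfplane:
  assumes hol: "q holomorphic_on ball 0 1"
    and pos: "\<And>z. z \<in> ball 0 1 \<Longrightarrow> Re (q z) > 0"
    and z: "z \<in> ball 0 1"
  shows "cmod (deriv q z) * (1 - (cmod z)\<^sup>2) \<le> 2 * Re (q z)"
proof -
  define F where "F = (\<lambda>w. (q w - 1) / (q w + 1))"
  have nz: "q w + 1 \<noteq> 0" if "w \<in> ball 0 1" for w
    using pos[OF that] by (auto simp: complex_eq_iff)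
  have id: "(cmod (u + 1))\<^sup>2 - (cmod (u - 1))\<^sup>2 = 4 * Re u" for u
    unfolding cmod_power2 by (simp add: power2_eq_square algebra_simps)
  have "cmod (F w) < 1" if "w \<in> ball 0 1" for w
  proof -
    have "(cmod (q w - 1))\<^sup>2 < (cmod (q w + 1))\<^sup>2"
      using id[of "q w"] pos[OF that] by simp
    then have "cmod (q w - 1) < cmod (q w + 1)" by (simp add: power_less_imp_less_base)
    then show ?thesis using nz[OF that] by (simp add: F_def norm_divide)
  qed
  moreover have "F holomorphic_on ball 0 1"
    unfolding F_def using hol nz by (auto intro!: holomorphic_intros)
  ultimately have SP: "cmod (deriv F z) * (1 - (cmod z)\<^sup>2) \<le> 1 - (cmod (F z))\<^sup>2"
    using z by (intro Schwarz_Pick) auto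
  have "(q has_field_derivative deriv q z) (at z)"
    using hol z by (simp add: holomorphic_derivI)
  then have "(F has_field_derivative 2 * deriv q z / (q z + 1)\<^sup>2) (at z)"
    unfolding F_def using nz[OF z]
    by (auto intro!: derivative_eq_intros simp: field_simps power2_eq_square)
  then have dF: "cmod (deriv F z) = 2 * cmod (deriv q z) / (cmod (q z + 1))\<^sup>2"
    by (simp add: DERIV_imp_deriv norm_divide norm_mult norm_power)
  have P: "(cmod (q z + 1))\<^sup>2 > 0" using nz[OF z] by simp
  have "1 - (cmod (F z))\<^sup>2 = 4 * Re (q z) / (cmod (q z + 1))\<^sup>2"
    unfolding F_def norm_divide power_divide using id[of "q z"] P by (simp add: field_simps)
  with SP dF have "2 * cmod (deriv q z) * (1 - (cmod z)\<^sup>2) / (cmod (q z + 1))\<^sup>2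
      \<le> 4 * Re (q z) / (cmod (q z + 1))\<^sup>2" by simp
  then show ?thesis using P by (simp add: divide_le_cancel)
qed

lemma Re_csqrt_pos:
  assumes "w \<notin> \<real>\<^sub>\<le>\<^sub>0"
  shows "Re (csqrt w) > 0"
proof (rule ccontr)
  assume "\<not> Re (csqrt w) > 0"
  then have "Re (csqrt w) = 0" using csqrt_principal[of w] by auto
  then have "(csqrt w)\<^sup>2 = of_real (- (Im (csqrt w))\<^sup>2)"
    by (simp add: complex_eq_iff power2_eq_square)
  then have "w = of_real (- (Im (csqrt w))\<^sup>2)" by simp
  then have "w \<in> \<real>\<^sub>\<le>\<^sub>0" by (metis nonpos_Reals_of_real_iff neg_le_0_iff_le zero_le_power2)
  with assms show False by simp
qed

text \<open>A square root maps the complement of the ray into a half plane, so no form of the Koebe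
  quarter theorem is needed.\<close>

lemma deriv_bound_omit_ray:
  assumes hol: "f holomorphic_on ball 0 1"
    and omit: "\<And>z t. z \<in> ball 0 1 \<Longrightarrow> t \<ge> 0 \<Longrightarrow> f z \<noteq> b + of_real t * d"
    and d: "cmod d = 1"
    and z: "z \<in> ball 0 1"
  shows "cmod (deriv f z) * (1 - (cmod z)\<^sup>2) \<le> 4 * cmod (f z - b)"
proof -
  \<comment> \<open>\<open>u\<close> turns the omitted ray into the nonpositive real axis, the
    branch cut of \<open>csqrt\<close>.\<close>
  define u where "u = (\<lambda>w. - ((f w - b) / d))"
  define q where "q = (\<lambda>w. csqrt (u w))"
  have d0: "d \<noteq> 0" using d by auto
  have u: "u w \<notin> \<real>\<^sub>\<le>\<^sub>0" if "w \<in> ball 0 1" for w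
  proof
    assume "u w \<in> \<real>\<^sub>\<le>\<^sub>0"
    then obtain r where r: "u w = of_real r" "r \<le> 0" by (auto elim!: nonpos_Reals_cases)
    then have "f w = b + of_real (- r) * d"
      using d0 unfolding u_def by (simp add: field_simps)
    with omit[OF that, of "- r"] r show False by simp
  qed
  have u_hol: "u holomorphic_on ball 0 1"
    unfolding u_def using hol d0 by (auto intro!: holomorphic_intros)
  have q_hol: "q holomorphic_on ball 0 1"
    unfolding q_def using u_hol u by (auto intro!: holomorphic_intros)
  have q_pos: "Re (q w) > 0" if "w \<in> ball 0 1" for w
    unfolding q_def using u[OF that] by (rule Re_csqrt_pos)
  have SP: "cmod (deriv q z) * (1 - (cmod z)\<^sup>2) \<le> 2 * Re (q z)"
    using q_hol q_pos z by (rule Schwarz_Pick_halfplane)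
  have qz: "(q w)\<^sup>2 = u w" for w by (simp add: q_def)
  have f_eq: "f w = b - d * (q w)\<^sup>2" for w
    unfolding qz u_def using d0 by simp
  have "(q has_field_derivative deriv q z) (at z)"
    using q_hol z by (simp add: holomorphic_derivI)
  then have "(f has_field_derivative - (d * (2 * q z * deriv q z))) (at z)"
    unfolding f_eq[abs_def] by (auto intro!: derivative_eq_intros)
  then have "cmod (deriv f z) = 2 * cmod (q z) * cmod (deriv q z)"
    using d by (simp add: DERIV_imp_deriv norm_mult)
  then have "cmod (deriv f z) * (1 - (cmod z)\<^sup>2) = 2 * cmod (q z) * (cmod (deriv q z) * (1 - (cmod z)\<^sup>2))"
    by simp
  \<comment> \<open>One factor 2|q| comes from differentiating f = b - d q^2, the other from
    Schwarz--Pick and Re q \<le> |q|; together they give 4|q|^2.\<close>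
  also have "\<dots> \<le> 2 * cmod (q z) * (2 * cmod (q z))"
    using SP complex_Re_le_cmod[of "q z"] by (intro mult_left_mono) auto
  also have "\<dots> = 4 * cmod (f z - b)"
    using d by (simp add: f_eq norm_mult norm_power power2_eq_square)
  finally show ?thesis .
qed

section \<open>Geometry of the comb\<close>

text \<open>A uniform lower bound \<open>c\<close> stands for the infimum of the gaps. As
  \<open>c > 1\<close>, the \<open>ln\<close> of every gap is at least \<open>ln c > 0\<close>, so
  an additive constant per room can be absorbed into \<open>S\<close>.\<close>

locale comb =
  fixes x :: "nat \<Rightarrow> real" and c :: real
  assumes x0: "x 0 = 0" and c_gt: "c > 1" and gap: "\<And>n. x (Suc n) - x n \<ge> c"
begin

lemma x_gap: "m < n \<Longrightarrow> x m + c \<le> x n"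
proof (induction n)
  case (Suc n)
  then show ?case using gap[of n] c_gt by (cases "m = n") auto
qed simp

lemma x_mono: "m \<le> n \<Longrightarrow> x m \<le> x n"
  using x_gap[of m n] c_gt by (cases "m = n") auto

lemma x_nonneg: "x n \<ge> 0"
  using x_mono[of 0 n] x0 by simp

lemma x1_gt: "x 1 > 1"
  using x_gap[of 0 1] x0 c_gt by simp

lemma x_ge: "real n \<le> x n"
proof (induction n)
  case (Suc n)
  then show ?case using gap[of n] c_gt by simp
qed (simp add: x0)

section \<open>Topology of the comb domain\<close>

lemma closed_range_x: "closed (range x)"
proof (rule discrete_imp_closed)
  show "\<forall>a\<in>range x. \<forall>b\<in>range x. dist b a < 1 \<longrightarrow> b = a"
  proof clarify
    fix m n assume "dist (x n) (x m) < 1"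
    then show "x n = x m"
      using x_gap[of m n] x_gap[of n m] c_gt by (cases m n rule: linorder_cases) (auto simp: dist_real_def)
  qed
qed simp

lemma comb_domain_iff:
  "z \<in> comb_domain x \<longleftrightarrow> Re z > - x 1 \<and> (Re z \<in> range x \<longrightarrow> \<bar>Im z\<bar> < 1)"
  by (auto simp: comb_domain_def complex_eq_iff not_le)

lemma open_comb: "open (comb_domain x)"
proof -
  have "comb_domain x = {z. - x 1 < Re z} - (Re -` range x \<inter> (\<lambda>z. \<bar>Im z\<bar>) -` {1..})"
    by (auto simp: comb_domain_iff)
  moreover have "closed (Re -` range x \<inter> (\<lambda>z. \<bar>Im z\<bar>) -` {1..})"
    by (intro closed_Int closed_vimage closed_range_x continuous_intros closed_atLeast)
  ultimately show ?thesis
    by (auto intro!: open_Diff open_halfspace_Re_gt)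
qed

lemma of_real_in_comb: "t > - x 1 \<Longrightarrow> of_real t \<in> comb_domain x"
  by (auto simp: comb_domain_iff)

text \<open>Every point is joined to the real axis by a vertical segment inside the comb, and the
  axis to the right of \<open>- x 1\<close> avoids all teeth because they start at height 1.\<close>

lemma connected_comb: "connected (comb_domain x)"
proof -
  define A where "A = complex_of_real ` {- x 1<..}"
  define T where "T z = A \<union> closed_segment (of_real (Re z)) z" for z
  have A: "connected A" unfolding A_def
    by (intro connected_continuous_image continuous_intros) auto
  have seg: "closed_segment (of_real (Re z)) z \<subseteq> comb_domain x" if "z \<in> comb_domain x" for z
  proof
    fix w assume "w \<in> closed_segment (of_real (Re z)) z"
    then obtain u where u: "0 \<le> u" "u \<le> 1" "w = (1 - u) *\<^sub>R of_real (Re z) + u *\<^sub>R z"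
      by (auto simp: closed_segment_def)
    then have "Re w = Re z" "\<bar>Im w\<bar> = u * \<bar>Im z\<bar>"
      using u(1) unfolding u(3) by (auto simp: abs_mult left_diff_distrib)
    moreover have "u * \<bar>Im z\<bar> \<le> \<bar>Im z\<bar>" using u by (simp add: mult_left_le_one_le)
    ultimately show "w \<in> comb_domain x" using that by (auto simp: comb_domain_iff)
  qed
  have "T z \<subseteq> comb_domain x" "z \<in> T z" if "z \<in> comb_domain x" for z
    using seg[OF that] of_real_in_comb by (auto simp: T_def A_def)
  then have "comb_domain x = \<Union> (T ` comb_domain x)" by blast
  moreover have "connected (\<Union> (T ` comb_domain x))"
  proof (rule connected_Union)
    show "connected S" if "S \<in> T ` comb_domain x" for S
    proof -
      from that obtain z where z: "z \<in> comb_domain x" "S = T z" by auto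
      then have "of_real (Re z) \<in> A \<inter> closed_segment (of_real (Re z)) z"
        by (auto simp: A_def comb_domain_iff)
      then show ?thesis unfolding z(2) T_def
        by (intro connected_Un A connected_segment) blast
    qed
    have "0 \<in> A" unfolding A_def using x1_gt by (intro image_eqI[of _ _ 0]) auto
    then have "0 \<in> \<Inter> (T ` comb_domain x)" by (auto simp: T_def)
    then show "\<Inter> (T ` comb_domain x) \<noteq> {}" by blast
  qed
  ultimately show ?thesis by simp
qed

text \<open>From any point of the complement the vertical ray pointing away from the real axis stays
  in the complement, so no component of the complement is bounded.\<close>

lemma simply_connected_comb: "simply_connected (comb_domain x)"
  unfolding simply_connected_eq_unbounded_complement_components[OF open_comb]
proof (intro conjI connected_comb ballI)
  fix K assume K: "K \<in> components (- comb_domain x)"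
  obtain z where z: "z \<in> K" using K in_components_nonempty by blast
  have zC: "z \<in> - comb_domain x" using z K in_components_subset by blast
  define s where "s = (if Im z \<ge> 0 then 1 else - 1 :: real)"
  define r where "r t = Complex (Re z) (Im z + s * t)" for t
  have con: "connected (r ` {0..})"
    unfolding r_def complex_eq by (intro connected_continuous_image continuous_intros) auto
  have "r t \<in> - comb_domain x" if "t \<ge> 0" for t
  proof -
    have "\<bar>Im z\<bar> \<le> \<bar>Im z + s * t\<bar>" using that by (auto simp: s_def)
    then show ?thesis using zC by (auto simp: comb_domain_iff r_def)
  qed
  then have "r ` {0..} \<subseteq> - comb_domain x" by auto
  moreover have "z \<in> r ` {0..}" by (intro image_eqI[of _ _ 0]) (auto simp: r_def complex_eq_iff)
  ultimately have sub: "r ` {0..} \<subseteq> K"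
    using components_maximal[OF K con] z by blast
  show "\<not> bounded K"
  proof
    assume "bounded K"
    then obtain B where B: "\<And>w. w \<in> K \<Longrightarrow> cmod w \<le> B" by (auto simp: bounded_iff)
    define t where "t = \<bar>B\<bar> + 1"
    have "r t \<in> K" using sub by (auto simp: t_def)
    then have "\<bar>Im (r t)\<bar> \<le> B" using B abs_Im_le_cmod order_trans by blast
    moreover have "\<bar>Im (r t)\<bar> \<ge> t" by (auto simp: r_def s_def t_def)
    ultimately show False by (simp add: t_def)
  qed
qed

lemma Riemann_map_comb_exists: "\<exists>f. Riemann_map f (comb_domain x)"
proof (rule Riemann_map_exists[OF open_comb simply_connected_comb])
  show "comb_domain x \<noteq> {}" using of_real_in_comb[of 0] x1_gt by auto
  have "of_real (- x 1) \<notin> comb_domain x" by (simp add: comb_domain_iff)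
  then show "comb_domain x \<noteq> UNIV" by blast
qed

section \<open>Comparison of \<open>h\<close> with the logarithmic sums \<open>S\<close>\<close>

definition d :: "real \<Rightarrow> real" where "d s = infdist s (range x)"

text \<open>Hyperbolic distances along the real axis are compared with \<open>h\<close>. The density \<open>1 / (1 + d s)\<close>
  is, up to a factor, the reciprocal of the distance of \<open>s\<close> to the boundary of the comb, because the
  tips of the teeth have height \<open>1\<close>.\<close>

definition h :: "real \<Rightarrow> real" where "h t = integral {- x 1..t} (\<lambda>s. 1 / (1 + d s))"

definition S :: "nat \<Rightarrow> real" where "S n = (\<Sum>i=1..n. ln (x i - x (i - 1)))"

lemma d_nonneg: "d s \<ge> 0" by (simp add: d_def infdist_nonneg)

lemma d_le: "d s \<le> \<bar>s - x k\<bar>"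
  using infdist_le[of "x k" "range x" s] by (simp add: d_def dist_real_def)

lemma d_attained: "\<exists>k. d s = \<bar>s - x k\<bar>"
  using infdist_attains_inf[OF closed_range_x, of s] by (auto simp: d_def dist_real_def)

lemma h_deriv:
  assumes "t > - x 1"
  shows "(h has_real_derivative 1 / (1 + d t)) (at t)"
proof -
  have nz: "1 + d s \<noteq> 0" for s using d_nonneg[of s] by linarith
  \<comment> \<open>The interval extends past \<open>t\<close> so that \<open>t\<close> is an
    interior point and the derivative is two-sided.\<close>
  have "continuous_on {- x 1..t + 1} (\<lambda>s. 1 / (1 + d s))"
    unfolding d_def by (intro continuous_intros) (use nz d_def in auto)
  then have "((\<lambda>u. integral {- x 1..u} (\<lambda>s. 1 / (1 + d s))) has_real_derivative 1 / (1 + d t)) (at t within {- x 1..t + 1})"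
    using assms by (intro integral_has_real_derivative) auto
  moreover have "at t within {- x 1..t + 1} = at t"
    using assms by (intro at_within_interior) auto
  ultimately show ?thesis unfolding h_def[abs_def] by simp
qed

lemma h_mono:
  assumes "- x 1 < s" "s \<le> t"
  shows "h s \<le> h t"
proof (rule DERIV_nonneg_imp_nondecreasing[OF assms(2)])
  fix u assume "s \<le> u" "u \<le> t"
  then show "\<exists>y. (h has_real_derivative y) (at u) \<and> 0 \<le> y"
    using h_deriv[of u] d_nonneg[of u] assms by (intro exI[of _ "1 / (1 + d u)"]) auto
qed

text \<open>Throughout the room \<open>d t \<le> t - x n\<close>, so \<open>h\<close> grows at least
  as fast as \<open>ln (1 + (t - x n))\<close>.\<close>

lemma h_step_lower: "ln (1 + (x (Suc n) - x n)) \<le> h (x (Suc n)) - h (x n)"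
proof -
  define G where "G t = h t - ln (1 + (t - x n))" for t
  have "G (x n) \<le> G (x (Suc n))"
  proof (rule DERIV_nonneg_imp_nondecreasing[where f = G])
    fix t assume t: "x n \<le> t" "t \<le> x (Suc n)"
    have pos: "t > - x 1" "1 + (t - x n) > 0" using t x_nonneg[of n] x1_gt by auto
    have "(G has_real_derivative (1 / (1 + d t) - 1 / (1 + (t - x n)))) (at t)"
      unfolding G_def using pos by (auto intro!: derivative_eq_intros h_deriv simp: divide_simps)
    moreover have "1 / (1 + (t - x n)) \<le> 1 / (1 + d t)"
      using d_le[of t n] d_nonneg[of t] t by (intro divide_left_mono) auto
    ultimately show "\<exists>y. (G has_real_derivative y) (at t) \<and> 0 \<le> y"
      by (intro exI conjI) auto
  qed (use gap[of n] c_gt in auto)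
  then show ?thesis by (simp add: G_def)
qed

text \<open>The nearest tooth lies on one side of the room, so the density is at most the sum of the
  densities measured from its two walls. Each of these integrates to \<open>ln\<close> of one plus
  the gap, whence the factor 2.\<close>

lemma h_step_upper: "h (x (Suc n)) - h (x n) \<le> 2 * ln (1 + (x (Suc n) - x n))"
proof -
  define G where "G t = ln (1 + (t - x n)) - ln (1 + (x (Suc n) - t)) - h t" for t
  have "G (x n) \<le> G (x (Suc n))"
  proof (rule DERIV_nonneg_imp_nondecreasing[where f = G])
    fix t assume t: "x n \<le> t" "t \<le> x (Suc n)"
    have pos: "t > - x 1" "1 + (t - x n) > 0" "1 + (x (Suc n) - t) > 0"
      using t x_nonneg[of n] x1_gt by auto
    have D: "(G has_real_derivative (1 / (1 + (t - x n)) + 1 / (1 + (x (Suc n) - t)) - 1 / (1 + d t))) (at t)"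
      unfolding G_def using pos by (auto intro!: derivative_eq_intros h_deriv simp: divide_simps)
    obtain k where k: "d t = \<bar>t - x k\<bar>" using d_attained by blast
    have "1 / (1 + d t) \<le> 1 / (1 + (t - x n)) + 1 / (1 + (x (Suc n) - t))"
    proof (cases "k \<le> n")
      case True
      then have "t - x n \<le> d t" using x_mono[of k n] k t by auto
      then have "1 / (1 + d t) \<le> 1 / (1 + (t - x n))"
        using pos d_nonneg[of t] t by (intro divide_left_mono) auto
      then show ?thesis using pos by (simp add: add_increasing2)
    next
      case False
      then have "x (Suc n) - t \<le> d t" using x_mono[of "Suc n" k] k t by auto
      then have "1 / (1 + d t) \<le> 1 / (1 + (x (Suc n) - t))"
        using pos d_nonneg[of t] t by (intro divide_left_mono) auto
      then show ?thesis using pos by (simp add: add_increasing)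
    qed
    with D show "\<exists>y. (G has_real_derivative y) (at t) \<and> 0 \<le> y"
      by (intro exI conjI) auto
  qed (use gap[of n] c_gt in auto)
  then show ?thesis by (simp add: G_def)
qed

lemma S_0: "S 0 = 0" by (simp add: S_def)

lemma S_Suc: "S (Suc n) = S n + ln (x (Suc n) - x n)"
  by (simp add: S_def)

lemma S_le_h: "S n \<le> h (x n) - h 0"
proof (induction n)
  case (Suc n)
  have "ln (x (Suc n) - x n) \<le> ln (1 + (x (Suc n) - x n))" using gap[of n] c_gt by simp
  then show ?case using Suc h_step_lower[of n] by (simp add: S_Suc)
qed (simp add: S_0 x0)

text \<open>The leading 2 is the factor of \<open>h_step_upper\<close>. A gap
  \<open>a \<ge> c\<close> satisfies
  \<open>ln (1 + a) \<le> ln 2 + ln a \<le> (1 + ln 2 / ln c) * ln a\<close>, which gives the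
  rest.\<close>

definition K where "K = 2 * (1 + ln 2 / ln c)"

lemma K_pos: "K > 0"
  unfolding K_def using c_gt by (simp add: add_pos_pos)

lemma h_le_S: "h (x n) - h 0 \<le> K * S n"
proof (induction n)
  case (Suc n)
  define a where "a = x (Suc n) - x n"
  have a: "a \<ge> c" using gap[of n] by (simp add: a_def)
  have "ln (1 + a) \<le> ln (2 * a)" using a c_gt by simp
  also have "\<dots> = ln 2 + ln a" using a c_gt by (simp add: ln_mult)
  also have "\<dots> \<le> ln 2 / ln c * ln a + ln a"
  proof -
    have "ln 2 / ln c * ln c \<le> ln 2 / ln c * ln a"
      using a c_gt by (intro mult_left_mono) auto
    then show ?thesis using c_gt by simp
  qed
  finally have "2 * ln (1 + a) \<le> 2 * (ln 2 / ln c * ln a + ln a)" by simp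
  also have "\<dots> = K * ln a" by (simp add: K_def algebra_simps)
  finally have "2 * ln (1 + a) \<le> K * ln a" .
  then show ?case using Suc h_step_upper[of n] by (simp add: S_Suc a_def algebra_simps)
qed (simp add: S_0 x0)

end

section \<open>Growth of a Riemann map onto the comb\<close>

lemma one_minus_le_one_minus_square:
  fixes r :: real
  assumes "0 \<le> r" "r \<le> 1"
  shows "1 - r \<le> 1 - r\<^sup>2"
  using assms by (simp add: power2_eq_square mult_left_le)

locale comb_map = comb +
  fixes f :: "complex \<Rightarrow> complex"
  assumes Riemann: "Riemann_map f (comb_domain x)"
begin

lemma f_hol: "f holomorphic_on ball 0 1"
  using Riemann by (simp add: Riemann_map_def)

lemma f_bij: "bij_betw f (ball 0 1) (comb_domain x)"
  using Riemann by (simp add: Riemann_map_def)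

lemma f_in: "z \<in> ball 0 1 \<Longrightarrow> f z \<in> comb_domain x"
  using f_bij by (auto simp: bij_betw_def)

lemma f_deriv: "z \<in> ball 0 1 \<Longrightarrow> (f has_field_derivative deriv f z) (at z)"
  using f_hol by (simp add: holomorphic_derivI)

section \<open>Distortion of \<open>f\<close> in terms of the distance to the teeth\<close>

text \<open>The vertical ray that leaves a tooth point at height \<open>y\<close> outwards is
  omitted by \<open>f\<close>, so \<open>deriv_bound_omit_ray\<close> applies with that point as the
  end of the ray.\<close>

lemma deriv_bound_tip:
  assumes z: "z \<in> ball 0 1" and y: "\<bar>y\<bar> \<ge> 1"
  shows "cmod (deriv f z) * (1 - cmod z) \<le> 4 * cmod (f z - Complex (x k) y)"
proof -
  define s where "s = (if y \<ge> 0 then 1 else - 1 :: real)"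
  have "cmod (deriv f z) * (1 - (cmod z)\<^sup>2) \<le> 4 * cmod (f z - Complex (x k) y)"
  proof (rule deriv_bound_omit_ray[OF f_hol _ _ z])
    fix w :: complex and t :: real assume w: "w \<in> ball 0 1" "0 \<le> t"
    show "f w \<noteq> Complex (x k) y + of_real t * Complex 0 s"
    proof
      assume eq: "f w = Complex (x k) y + of_real t * Complex 0 s"
      have "Re (f w) = x k" "\<bar>Im (f w)\<bar> \<ge> 1" using w y by (auto simp: eq s_def)
      with f_in[OF w(1)] show False by (auto simp: comb_domain_iff)
    qed
  qed (simp add: s_def cmod_def)
  moreover have "cmod (deriv f z) * (1 - cmod z) \<le> cmod (deriv f z) * (1 - (cmod z)\<^sup>2)"
    using z by (intro mult_left_mono one_minus_le_one_minus_square) auto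
  ultimately show ?thesis by simp
qed

lemma deriv_bound_d:
  assumes z: "z \<in> ball 0 1"
  shows "cmod (deriv f z) * (1 - cmod z) \<le> 4 * (1 + d (Re (f z)))"
proof -
  obtain k where k: "d (Re (f z)) = \<bar>Re (f z) - x k\<bar>" using d_attained by blast
  \<comment> \<open>The point closest to \<open>f z\<close> on the nearest tooth has the height of
    \<open>f z\<close> clipped to absolute value at least 1; the vertical error is then at most
    1.\<close>
  define y where "y = (if Im (f z) \<ge> 0 then max 1 (Im (f z)) else min (- 1) (Im (f z)))"
  have "cmod (deriv f z) * (1 - cmod z) \<le> 4 * cmod (f z - Complex (x k) y)"
    by (rule deriv_bound_tip[OF z]) (auto simp: y_def)
  moreover have "cmod (f z - Complex (x k) y) \<le> \<bar>Re (f z) - x k\<bar> + \<bar>Im (f z) - y\<bar>"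
    using cmod_le[of "f z - Complex (x k) y"] by simp
  moreover have "\<bar>Im (f z) - y\<bar> \<le> 1" by (auto simp: y_def)
  ultimately show ?thesis using k by simp
qed

text \<open>Beyond height 1 every tooth has a boundary point level with \<open>f z\<close>, so only
  the horizontal distance enters. The estimate is used with a wall to the right of
  \<open>f z\<close>.\<close>

lemma deriv_bound_wall:
  assumes z: "z \<in> ball 0 1" and "\<bar>Im (f z)\<bar> \<ge> 1"
  shows "cmod (deriv f z) * (1 - cmod z) \<le> 4 * \<bar>x k - Re (f z)\<bar>"
proof -
  have "f z - Complex (x k) (Im (f z)) = of_real (Re (f z) - x k)"
    by (simp add: complex_eq_iff)
  then have "cmod (f z - Complex (x k) (Im (f z))) = \<bar>x k - Re (f z)\<bar>"
    by (simp only: norm_of_real abs_minus_commute)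
  with deriv_bound_tip[OF assms, of k] show ?thesis by simp
qed

text \<open>The integral of \<open>1 / (1 - \<rho>)\<close> over [0, |z|]. For the metric density
  \<open>2 / (1 - \<rho> ^ 2)\<close> it is within \<open>ln 2\<close> of the hyperbolic distance
  from 0 to \<open>z\<close>.\<close>

definition L :: "complex \<Rightarrow> real" where "L z = - ln (1 - cmod z)"

lemma L_nonneg: "z \<in> ball 0 1 \<Longrightarrow> L z \<ge> 0"
  unfolding L_def by simp

section \<open>Integration of the distortion bounds along radii\<close>

lemma radius_in: "(z :: complex) \<in> ball 0 1 \<Longrightarrow> 0 \<le> t \<Longrightarrow> t \<le> 1 \<Longrightarrow> of_real t * z \<in> ball 0 1"
  using mult_left_le_one_le[of "cmod z" t] by (auto simp: norm_mult)

lemma L_radius_deriv: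
  fixes z :: complex
  assumes "z \<in> ball 0 1" "0 \<le> t" "t \<le> 1"
  shows "((\<lambda>t. - ln (1 - t * cmod z)) has_real_derivative cmod z / (1 - t * cmod z)) (at t)"
proof -
  have "1 - t * cmod z > 0" using radius_in[OF assms] assms(2) by (simp add: norm_mult)
  then show ?thesis by (auto intro!: derivative_eq_intros simp: divide_simps)
qed

lemma f_radius_deriv:
  assumes "z \<in> ball 0 1" "0 \<le> t" "t \<le> 1"
  shows "((\<lambda>t. f (of_real t * z)) has_vector_derivative deriv f (of_real t * z) * z) (at t)"
proof -
  have "((\<lambda>w. f (w * z)) has_field_derivative deriv f (of_real t * z) * z) (at (of_real t))"
    by (rule DERIV_chain2[where f = f and g = "\<lambda>w. w * z", OF f_deriv[OF radius_in[OF assms]]]) (auto intro!: derivative_eq_intros)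
  then show ?thesis by (rule has_vector_derivative_real_field)
qed

lemma Re_Im_radius_deriv:
  assumes "z \<in> ball 0 1" "0 \<le> t" "t \<le> 1"
  shows "((\<lambda>t. Re (f (of_real t * z))) has_real_derivative Re (deriv f (of_real t * z) * z)) (at t)"
    and "((\<lambda>t. Im (f (of_real t * z))) has_real_derivative Im (deriv f (of_real t * z) * z)) (at t)"
  using bounded_linear.has_vector_derivative[OF bounded_linear_Re f_radius_deriv[OF assms]] bounded_linear.has_vector_derivative[OF bounded_linear_Im f_radius_deriv[OF assms]]
  by (simp_all add: has_real_derivative_iff_has_vector_derivative)

text \<open>Along the radius the derivative of \<open>h\<close> composed with the real part of
  \<open>f\<close> is at most |f'| |z| / (1 + d), which \<open>deriv_bound_d\<close> bounds by 4
  times the derivative of \<open>L\<close>.\<close>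

lemma h_Re_le:
  assumes z: "z \<in> ball 0 1"
  shows "h (Re (f z)) \<le> h (Re (f 0)) + 4 * L z"
proof -
  define G where "G t = h (Re (f (of_real t * z))) - 4 * (- ln (1 - t * cmod z))" for t
  have "G 1 \<le> G 0"
  proof (rule DERIV_nonpos_imp_nonincreasing[where f = G])
    fix t :: real assume t: "0 \<le> t" "t \<le> 1"
    let ?w = "of_real t * z"
    have w: "?w \<in> ball 0 1" using z t by (rule radius_in)
    have pos: "1 - t * cmod z > 0" using w t by (simp add: norm_mult)
    have dpos: "1 + d (Re (f ?w)) > 0" using d_nonneg[of "Re (f ?w)"] by linarith
    have gt: "Re (f ?w) > - x 1" using f_in[OF w] by (simp add: comb_domain_iff)
    have D: "(G has_real_derivative (1 / (1 + d (Re (f ?w))) * Re (deriv f ?w * z)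
        - 4 * (cmod z / (1 - t * cmod z)))) (at t)"
      unfolding G_def
      by (rule DERIV_diff[OF DERIV_chain2[where f = h and g = "\<lambda>t. Re (f (of_real t * z))",
              OF h_deriv[OF gt] Re_Im_radius_deriv(1)[OF z t]] DERIV_cmult[OF L_radius_deriv[OF z t]]])
    have "Re (deriv f ?w * z) \<le> cmod (deriv f ?w) * cmod z"
      using complex_Re_le_cmod[of "deriv f ?w * z"] by (simp add: norm_mult)
    also have "\<dots> \<le> 4 * (1 + d (Re (f ?w))) / (1 - t * cmod z) * cmod z"
      using deriv_bound_d[OF w] pos t by (intro mult_right_mono) (auto simp: norm_mult field_simps)
    finally have "1 / (1 + d (Re (f ?w))) * Re (deriv f ?w * z) \<le> 4 * (cmod z / (1 - t * cmod z))"
      using dpos pos by (simp add: field_simps)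
    with D show "\<exists>y. (G has_real_derivative y) (at t) \<and> y \<le> 0" by (intro exI conjI) auto
  qed simp
  then show ?thesis by (simp add: G_def L_def)
qed

text \<open>After the last time the image of the radius has imaginary part at most \<open>1\<close> in absolute value,
  it stays in one room and hence at distance at most \<open>x n + x 1\<close> from the wall at \<open>x n\<close>.\<close>

lemma abs_Im_le:
  assumes z: "z \<in> ball 0 1" and le: "Re (f z) \<le> x n"
  shows "\<bar>Im (f z)\<bar> \<le> 1 + \<bar>Im (f 0)\<bar> + 4 * (x n + x 1) * L z"
proof (cases "\<bar>Im (f z)\<bar> \<le> 1")
  case True
  then show ?thesis using L_nonneg[OF z] x_nonneg[of n] x1_gt by (simp add: add_increasing2)
next
  case False
  define \<gamma> where "\<gamma> t = f (of_real t * z)" for t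
  define A where "A = {t \<in> {0..1}. \<bar>Im (\<gamma> t)\<bar> \<le> 1}"
  have cont: "continuous_on {0..1} \<gamma>"
    unfolding \<gamma>_def
    by (intro continuous_at_imp_continuous_on ballI has_vector_derivative_continuous[OF f_radius_deriv[OF z]]) auto
  have g1: "\<gamma> 1 = f z" and g0: "\<gamma> 0 = f 0" by (simp_all add: \<gamma>_def)
  \<comment> \<open>\<open>t0\<close> is the last time at height at most 1, or 0 if there is none;
    in the latter case the height at \<open>t0\<close> is that of \<open>f 0\<close>, hence the sum
    of both bounds.\<close>
  have "\<exists>t0. 0 \<le> t0 \<and> t0 < 1 \<and> \<bar>Im (\<gamma> t0)\<bar> \<le> 1 + \<bar>Im (f 0)\<bar> \<and> (\<forall>t. t0 < t \<and> t \<le> 1 \<longrightarrow> \<bar>Im (\<gamma> t)\<bar> > 1)"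
  proof (cases "A = {}")
    case True
    then show ?thesis by (intro exI[of _ 0]) (fastforce simp: A_def g0)
  next
    case ne: False
    have "closed A"
      unfolding A_def by (intro continuous_on_closed_Collect_le continuous_intros cont)
    moreover have "A \<inter> {0..1} = A" by (auto simp: A_def)
    ultimately have "compact A"
      using closed_Int_compact[of A "{0..1}"] by (simp add: \<open>A \<inter> {0..1} = A\<close>)
    then obtain t0 where t0: "t0 \<in> A" "\<And>t. t \<in> A \<Longrightarrow> t \<le> t0"
      using ne compact_attains_sup by metis
    have "t0 \<noteq> 1" using t0(1) False by (auto simp: A_def g1)
    moreover have "\<bar>Im (\<gamma> t)\<bar> > 1" if "t0 < t" "t \<le> 1" for t
    proof (rule ccontr)
      assume "\<not> \<bar>Im (\<gamma> t)\<bar> > 1"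
      then have "t \<in> A" using that t0(1) by (auto simp: A_def)
      with t0(2)[of t] that show False by simp
    qed
    ultimately show ?thesis using t0(1) by (intro exI[of _ t0]) (auto simp: A_def)
  qed
  then obtain t0 where t0: "0 \<le> t0" "t0 < 1" "\<bar>Im (\<gamma> t0)\<bar> \<le> 1 + \<bar>Im (f 0)\<bar>"
    and big: "\<And>t. t0 < t \<Longrightarrow> t \<le> 1 \<Longrightarrow> \<bar>Im (\<gamma> t)\<bar> > 1" by blast
  \<comment> \<open>The path ends with real part at most \<open>x n\<close>, so exceeding
    \<open>x n\<close> would force a later crossing of this line, which is possible only below
    height 1.\<close>
  have Re_le: "Re (\<gamma> t) \<le> x n" if t: "t0 < t" "t \<le> 1" for t
  proof (rule ccontr)
    assume "\<not> Re (\<gamma> t) \<le> x n"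
    moreover have "continuous_on {t..1} (\<lambda>s. Re (\<gamma> s))"
      by (intro continuous_intros continuous_on_subset[OF cont]) (use t t0 in auto)
    ultimately obtain s where s: "t \<le> s" "s \<le> 1" "Re (\<gamma> s) = x n"
      using IVT2'[of "\<lambda>s. Re (\<gamma> s)" 1 "x n" t] le t by (auto simp: g1)
    have "\<gamma> s \<in> comb_domain x" unfolding \<gamma>_def using s t t0 by (intro f_in radius_in z) auto
    then have "\<bar>Im (\<gamma> s)\<bar> < 1" using s(3) by (auto simp: comb_domain_iff)
    with big[of s] s t show False by simp
  qed
  \<comment> \<open>Multiplying by the final sign replaces the absolute value of \<open>Im\<close>
    by a differentiable function that agrees with it at time 1 and is no larger at
    \<open>t0\<close>.\<close>
  define \<sigma> where "\<sigma> = sgn (Im (f z))"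
  have \<sigma>: "\<bar>\<sigma>\<bar> = 1" "\<sigma> * Im (f z) = \<bar>Im (f z)\<bar>" using False by (auto simp: \<sigma>_def abs_sgn_eq sgn_if)
  define G where "G t = \<sigma> * Im (\<gamma> t) - 4 * (x n + x 1) * (- ln (1 - t * cmod z))" for t
  define G' where "G' t = \<sigma> * Im (deriv f (of_real t * z) * z) - 4 * (x n + x 1) * (cmod z / (1 - t * cmod z))" for t
  have D: "(G has_real_derivative G' t) (at t)" if "t0 \<le> t" "t \<le> 1" for t
    unfolding G_def G'_def \<gamma>_def
    by (rule DERIV_diff[OF DERIV_cmult[OF Re_Im_radius_deriv(2)] DERIV_cmult[OF L_radius_deriv]])
      (use that t0 z in auto)
  \<comment> \<open>The wall bound holds only after \<open>t0\<close>; the mean value theorem needs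
    the derivative only at one interior time.\<close>
  have "\<exists>l s. t0 < s \<and> s < 1 \<and> (G has_real_derivative l) (at s) \<and> G 1 - G t0 = (1 - t0) * l"
    using t0 D by (intro MVT) (auto intro!: DERIV_continuous_on DERIV_subset[OF D] simp: real_differentiable_def, (meson D less_imp_le)+)
  then obtain s l where s: "t0 < s" "s < 1" "(G has_real_derivative l) (at s)" "G 1 - G t0 = (1 - t0) * l"
    by blast
  have l: "l = G' s" using s D[of s] DERIV_unique by auto
  let ?w = "of_real s * z"
  have w: "?w \<in> ball 0 1" using z s t0 by (intro radius_in) auto
  have pos: "1 - s * cmod z > 0" using w s t0 by (simp add: norm_mult)
  have gt: "Re (f ?w) > - x 1" using f_in[OF w] by (simp add: comb_domain_iff)
  have "cmod (deriv f ?w) * (1 - cmod ?w) \<le> 4 * \<bar>x n - Re (f ?w)\<bar>"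
    using big[of s] s by (intro deriv_bound_wall w) (auto simp: \<gamma>_def)
  also have "\<dots> \<le> 4 * (x n + x 1)" using Re_le[of s] s gt by (auto simp: \<gamma>_def)
  finally have b: "cmod (deriv f ?w) \<le> 4 * (x n + x 1) / (1 - s * cmod z)"
    using pos s t0 by (simp add: norm_mult field_simps)
  have "\<sigma> * Im (deriv f ?w * z) \<le> \<bar>\<sigma> * Im (deriv f ?w * z)\<bar>" by simp
  also have "\<dots> \<le> cmod (deriv f ?w) * cmod z"
    using abs_Im_le_cmod[of "deriv f ?w * z"] \<sigma> by (simp add: abs_mult norm_mult)
  also have "\<dots> \<le> 4 * (x n + x 1) / (1 - s * cmod z) * cmod z"
    by (intro mult_right_mono b) auto
  finally have "G' s \<le> 0" by (simp add: G'_def)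
  then have "(1 - t0) * G' s \<le> 0" using t0 by (simp add: mult_nonneg_nonpos)
  then have "G 1 \<le> G t0" using s(4) l by simp
  moreover have "\<sigma> * Im (\<gamma> t0) \<le> \<bar>Im (\<gamma> t0)\<bar>"
    using \<sigma>(1) abs_ge_self[of "\<sigma> * Im (\<gamma> t0)"] by (simp add: abs_mult)
  moreover have "4 * (x n + x 1) * (- ln (1 - t0 * cmod z)) \<ge> 0"
  proof -
    have "0 < 1 - t0 * cmod z" using radius_in[OF z, of t0] t0 by (simp add: norm_mult)
    then show ?thesis using t0 x_nonneg[of n] x1_gt by (intro mult_nonneg_nonneg) auto
  qed
  ultimately show ?thesis using t0(3) \<sigma>(2) by (simp add: G_def g1 L_def)
qed

text \<open>The hypothesis uses \<open>S (n - 1)\<close> because a point of the room between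
  \<open>x (n - 1)\<close> and \<open>x n\<close> is only known to have passed
  \<open>x (n - 1)\<close>, whereas its modulus is controlled through \<open>x n\<close>.\<close>

lemma growth:
  assumes cond: "\<And>e. e > 0 \<Longrightarrow> \<exists>B. \<forall>n\<ge>1. ln (x n) \<le> e * S (n - 1) + B"
    and e: "e > 0"
  shows "\<exists>A>0. \<forall>z\<in>ball 0 1. cmod (f z) \<le> A * (1 - cmod z) powr (- e)"
proof -
  \<comment> \<open>\<open>h_Re_le\<close> carries a factor 4, so \<open>e / 8\<close> spends
    \<open>e / 2\<close> of the exponent; the other \<open>e / 2\<close> absorbs the factor
    \<open>1 + L z\<close> by means of \<open>\<delta>\<close>.\<close>
  obtain B where B: "\<And>n. n \<ge> 1 \<Longrightarrow> ln (x n) \<le> e / 8 * S (n - 1) + B"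
    using cond[of "e / 8"] e by auto
  define H0 where "H0 = \<bar>h (Re (f 0)) - h 0\<bar>"
  define \<delta> where "\<delta> = min (e / 2) 1"
  define a where "a = 10 + \<bar>Im (f 0)\<bar>"
  have \<delta>: "0 < \<delta>" "\<delta> \<le> 1" "\<delta> \<le> e / 2" using e by (auto simp: \<delta>_def)
  define A where "A = a / \<delta> * exp (e / 8 * H0 + B)"
  show ?thesis
  proof (intro exI[of _ A] conjI ballI)
    show "A > 0" using \<delta> by (simp add: A_def a_def)
    fix z :: complex assume z: "z \<in> ball 0 1"
    have L0: "L z \<ge> 0" using z by (rule L_nonneg)
    \<comment> \<open>The wall closing the room of \<open>f z\<close> on the right. The value
      \<open>n = 1\<close> also serves the points of negative real part, with
      \<open>S 0 = 0\<close>.\<close>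
    define n where "n = (LEAST n. n \<ge> 1 \<and> Re (f z) \<le> x n)"
    obtain m where "real m \<ge> Re (f z)" using real_arch_simple by blast
    then have ex: "Suc m \<ge> 1 \<and> Re (f z) \<le> x (Suc m)" using x_ge[of "Suc m"] by simp
    have n: "n \<ge> 1" "Re (f z) \<le> x n"
      using LeastI[of "\<lambda>n. n \<ge> 1 \<and> Re (f z) \<le> x n", OF ex] unfolding n_def by auto
    have Sn: "S (n - 1) \<le> H0 + 4 * L z"
    proof (cases "n = 1")
      case True
      then show ?thesis using L0 by (simp add: S_0 H0_def)
    next
      case False
      then have n2: "n - 1 \<ge> 1" "n - 1 < n" using n by auto
      have "\<not> Re (f z) \<le> x (n - 1)"
        using not_less_Least[of "n - 1" "\<lambda>n. n \<ge> 1 \<and> Re (f z) \<le> x n"] n2 unfolding n_def by auto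
      then have "h (x (n - 1)) \<le> h (Re (f z))"
        using x_nonneg[of "n - 1"] x1_gt by (intro h_mono) auto
      then show ?thesis using S_le_h[of "n - 1"] h_Re_le[OF z] by (simp add: H0_def)
    qed
    have xn: "x n \<ge> x 1" using n x_mono by simp
    have "\<bar>Re (f z)\<bar> \<le> x n" using f_in[OF z] n xn by (auto simp: comb_domain_iff)
    then have "cmod (f z) \<le> x n + \<bar>Im (f z)\<bar>" using cmod_le[of "f z"] by simp
    also have "\<dots> \<le> x n + (1 + \<bar>Im (f 0)\<bar> + 4 * (x n + x 1) * L z)"
      using abs_Im_le[OF z n(2)] by simp
    also have "\<dots> \<le> x n + (1 + \<bar>Im (f 0)\<bar>) * x n + 8 * x n * L z"
    proof -
      have "(1 + \<bar>Im (f 0)\<bar>) * 1 \<le> (1 + \<bar>Im (f 0)\<bar>) * x n"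
        using xn x1_gt by (intro mult_left_mono) auto
      moreover have "4 * (x n + x 1) * L z \<le> 8 * x n * L z"
        using xn L0 by (intro mult_right_mono) auto
      ultimately show ?thesis by simp
    qed
    also have "\<dots> \<le> a * x n + a * x n * L z"
    proof -
      have "8 * x n * L z \<le> a * x n * L z"
        using xn x1_gt L0 by (intro mult_right_mono) (auto simp: a_def)
      then show ?thesis using xn x1_gt by (simp add: a_def algebra_simps)
    qed
    also have "\<dots> = x n * (a * (1 + L z))" by (simp add: algebra_simps)
    also have "\<dots> \<le> exp (e / 8 * H0 + B + e / 2 * L z) * (a / \<delta> * exp (\<delta> * L z))"
    proof (rule mult_mono)
      have "e / 8 * S (n - 1) \<le> e / 8 * (H0 + 4 * L z)" using Sn e by (intro mult_left_mono) auto
      then have "ln (x n) \<le> e / 8 * H0 + B + e / 2 * L z" using B[of n] n by (simp add: algebra_simps)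
      then have "exp (ln (x n)) \<le> exp (e / 8 * H0 + B + e / 2 * L z)" by simp
      then show "x n \<le> exp (e / 8 * H0 + B + e / 2 * L z)" using xn x1_gt by simp
      have "1 + L z \<le> (1 + \<delta> * L z) / \<delta>" using \<delta> L0 by (simp add: field_simps)
      also have "\<dots> \<le> exp (\<delta> * L z) / \<delta>" using \<delta> by (intro divide_right_mono exp_ge_add_one_self) auto
      finally have "a * (1 + L z) \<le> a * (exp (\<delta> * L z) / \<delta>)" by (intro mult_left_mono) (auto simp: a_def)
      then show "a * (1 + L z) \<le> a / \<delta> * exp (\<delta> * L z)" by simp
    qed (use L0 in \<open>auto simp: a_def\<close>)
    also have "\<dots> = A * exp ((e / 2 + \<delta>) * L z)" by (simp add: A_def exp_add algebra_simps)
    also have "\<dots> \<le> A * exp (e * L z)"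
      using \<open>A > 0\<close> \<delta> L0 by (simp add: mult_right_mono)
    also have "exp (e * L z) = (1 - cmod z) powr (- e)"
      using z by (simp add: powr_def L_def)
    finally show "cmod (f z) \<le> A * (1 - cmod z) powr (- e)" .
  qed
qed

end

section \<open>Injective functions of slow growth lie in Hardy spaces\<close>

definition pair_vec :: "real \<times> real \<Rightarrow> real^2" where
  "pair_vec p = (\<chi> i. if i = 1 then fst p else snd p)"

lemma pair_vec_nth [simp]: "pair_vec p $ 1 = fst p" "pair_vec p $ 2 = snd p"
  by (simp_all add: pair_vec_def)

lemma Basis_real_2: "(Basis :: (real^2) set) = {axis 1 1, axis 2 1}"
  by (auto simp: Basis_vec_def UNIV_2)

lemma axis_1_neq_axis_2: "axis 1 1 \<noteq> (axis 2 1 :: real^2)"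
  by (simp add: axis_eq_axis)

lemma pair_vec_measurable [measurable]: "pair_vec \<in> borel_measurable (lborel \<Otimes>\<^sub>M lborel)"
proof -
  have "continuous_on UNIV pair_vec"
    unfolding pair_vec_def[abs_def]
  proof (rule continuous_on_vec_lambda)
    show "continuous_on UNIV (\<lambda>p. if i = 1 then fst p else snd p :: real)" for i :: 2
      by (cases "i = 1") (auto intro!: continuous_intros)
  qed
  then have "pair_vec \<in> borel_measurable borel" by (rule borel_measurable_continuous_onI)
  then show ?thesis by (simp add: lborel_prod)
qed

text \<open>A Borel measure that gives every box its volume is Lebesgue measure. This carries
  Tonelli's theorem over from pairs to \<open>real^2\<close>, where the change of variables takes
  place.\<close>

lemma lborel_eq_distr_pair_vec:
  "(lborel :: (real^2) measure) = distr (lborel \<Otimes>\<^sub>M lborel) borel pair_vec"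
proof (rule lborel_eqI)
  fix l u :: "real^2"
  assume "\<And>b. b \<in> Basis \<Longrightarrow> l \<bullet> b \<le> u \<bullet> b"
  from this[of "axis 1 1"] this[of "axis 2 1"] have le: "l $ 1 \<le> u $ 1" "l $ 2 \<le> u $ 2"
    by (simp_all add: Basis_real_2 inner_axis)
  have "pair_vec -` box l u \<inter> space (lborel \<Otimes>\<^sub>M lborel) = {l $ 1<..<u $ 1} \<times> {l $ 2<..<u $ 2}"
    by (auto simp: mem_box Basis_real_2 inner_axis space_pair_measure)
  then have "emeasure (distr (lborel \<Otimes>\<^sub>M lborel) borel pair_vec) (box l u) =
      emeasure (lborel \<Otimes>\<^sub>M lborel) ({l $ 1<..<u $ 1} \<times> {l $ 2<..<u $ 2})"
    by (simp add: emeasure_distr)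
  also have "\<dots> = ennreal (u $ 1 - l $ 1) * ennreal (u $ 2 - l $ 2)"
    using le by (simp add: lborel.emeasure_pair_measure_Times)
  also have "\<dots> = ennreal (\<Prod>b\<in>Basis. (u - l) \<bullet> b)"
    using le axis_1_neq_axis_2 by (simp add: Basis_real_2 inner_axis ennreal_mult)
  finally show "emeasure (distr (lborel \<Otimes>\<^sub>M lborel) borel pair_vec) (box l u) =
      ennreal (\<Prod>b\<in>Basis. (u - l) \<bullet> b)" .
qed simp

lemma nn_integral_real_2:
  assumes [measurable]: "F \<in> borel_measurable borel"
  shows "(\<integral>\<^sup>+v. F v \<partial>(lborel :: (real^2) measure)) =
    (\<integral>\<^sup>+\<theta>. \<integral>\<^sup>+\<rho>. F (pair_vec (\<rho>, \<theta>)) \<partial>lborel \<partial>lborel)"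
proof -
  have "(\<integral>\<^sup>+v. F v \<partial>(lborel :: (real^2) measure)) = (\<integral>\<^sup>+p. F (pair_vec p) \<partial>(lborel \<Otimes>\<^sub>M lborel))"
    by (subst lborel_eq_distr_pair_vec) (rule nn_integral_distr; measurable)
  also have "\<dots> = (\<integral>\<^sup>+\<theta>. \<integral>\<^sup>+\<rho>. F (pair_vec (\<rho>, \<theta>)) \<partial>lborel \<partial>lborel)"
    by (rule lborel_pair.nn_integral_snd[symmetric]) measurable
  finally show ?thesis .
qed

text \<open>A positive weight on the plane whose product form reduces its integral to that of 1 / (1
  + t^2) on the line. Its reciprocal grows at most like the fourth power of |w|, so slow growth of
  \<open>f\<close> makes it cheap to insert.\<close>

definition \<psi> :: "complex \<Rightarrow> real" where
  "\<psi> w = inverse (1 + (Re w)\<^sup>2) * inverse (1 + (Im w)\<^sup>2)"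

definition vec_complex :: "real^2 \<Rightarrow> complex" where
  "vec_complex v = Complex (v $ 1) (v $ 2)"

definition complex_vec :: "complex \<Rightarrow> real^2" where
  "complex_vec w = pair_vec (Re w, Im w)"

lemma vec_complex_vec [simp]: "vec_complex (complex_vec w) = w"
  by (simp add: vec_complex_def complex_vec_def)

lemma complex_vec_nth [simp]: "complex_vec w $ 1 = Re w" "complex_vec w $ 2 = Im w"
  by (simp_all add: complex_vec_def)

lemma bounded_linear_complex_vec: "bounded_linear complex_vec"
proof -
  have "linear complex_vec"
    by (rule linearI) (simp_all add: vec_eq_iff forall_2)
  then show ?thesis by (simp add: linear_conv_bounded_linear)
qed

lemma \<psi>_pos: "\<psi> w > 0"
proof -
  have "1 + (Re w)\<^sup>2 > 0" "1 + (Im w)\<^sup>2 > 0" by (simp_all add: add_pos_nonneg)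
  then show ?thesis by (simp add: \<psi>_def)
qed

lemma nn_integral_\<psi>_finite: "(\<integral>\<^sup>+v. ennreal (\<psi> (vec_complex v)) \<partial>lborel) < \<infinity>"
proof -
  define g where "g = (\<lambda>t::real. inverse (1 + t\<^sup>2))"
  have g0: "g t \<ge> 0" for t unfolding g_def by (simp add: add_nonneg_nonneg)
  have "set_integrable lborel (einterval (-\<infinity>) \<infinity>) g"
    unfolding g_def by (rule integrable_inverse_1_plus_square)
  then have "integrable lborel g" by (simp add: set_integrable_def einterval_def)
  then have fin: "(\<integral>\<^sup>+t. ennreal (g t) \<partial>lborel) < \<infinity>"
    using g0 by (simp add: nn_integral_eq_integral)
  have "(\<integral>\<^sup>+v. ennreal (\<psi> (vec_complex v)) \<partial>lborel)
      = (\<integral>\<^sup>+v. (\<Prod>b\<in>Basis. ennreal (g (v \<bullet> b))) \<partial>(lborel :: (real^2) measure))"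
    using axis_1_neq_axis_2 g0 
    by (simp add: Basis_real_2 inner_axis \<psi>_def vec_complex_def g_def ennreal_mult)
  also have "\<dots> = (\<Prod>b\<in>(Basis :: (real^2) set). (\<integral>\<^sup>+t. ennreal (g t) \<partial>lborel))"
    by (rule nn_integral_lborel_prod) (auto simp: g_def)
  also have "\<dots> < \<infinity>"
    using fin axis_1_neq_axis_2 by (simp add: Basis_real_2 ennreal_mult_less_top)
  finally show ?thesis .
qed

text \<open>Change of variables for the injective map \<open>(\<rho>, \<theta>) \<mapsto> f (\<rho> * cis \<theta>)\<close>, whose Jacobian is
  \<open>\<rho> * \<bar>f'\<bar>\<^sup>2\<close>.\<close>

lemma nn_integral_polar_le:
  fixes r :: real
  assumes hol: "f holomorphic_on ball 0 1" and inj: "inj_on f (ball 0 1)" and r: "r < 1"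
  shows "(\<integral>\<^sup>+\<theta>. \<integral>\<^sup>+\<rho>. indicator {0<..<2*pi} \<theta> * (indicator {1/2<..<r} \<rho> *
      ennreal (\<rho> * (cmod (deriv f (of_real \<rho> * cis \<theta>)))\<^sup>2 * \<psi> (f (of_real \<rho> * cis \<theta>)))) \<partial>lborel \<partial>lborel)
    \<le> (\<integral>\<^sup>+v. ennreal (\<psi> (vec_complex v)) \<partial>lborel)" (is "?I \<le> ?\<Psi>")
    and "(\<lambda>\<theta>. \<integral>\<^sup>+\<rho>. indicator {0<..<2*pi} \<theta> * (indicator {1/2<..<r} \<rho> *
      ennreal (\<rho> * (cmod (deriv f (of_real \<rho> * cis \<theta>)))\<^sup>2 * \<psi> (f (of_real \<rho> * cis \<theta>)))) \<partial>lborel)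
      \<in> borel_measurable borel" (is "?F \<in> _")
proof -
  define w where "w v = of_real (v $ 1) * exp (\<i> * of_real (v $ 2))" for v :: "real^2"
  define G where "G v = complex_vec (f (w v))" for v
  define G' where "G' v h = complex_vec (deriv f (w v) * (of_real (h $ 1) * exp (\<i> * of_real (v $ 2)) +
      of_real (h $ 2) * (\<i> * w v)))" for v h :: "real^2"
  \<comment> \<open>An open box on which polar coordinates are injective.\<close>
  define S where "S = {v :: real^2. v $ 1 \<in> {1/2<..<r} \<and> v $ 2 \<in> {0<..<2*pi}}"
  have S_eq: "S = box (pair_vec (1/2, 0)) (pair_vec (r, 2 * pi))"
    by (auto simp: S_def mem_box Basis_real_2 inner_axis)
  have S_open: "open S" by (simp add: S_eq open_box)
  have cmod_w: "cmod (w v) = \<bar>v $ 1\<bar>" for v by (simp add: w_def norm_mult)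
  have w_in: "w v \<in> ball 0 1" if "v \<in> S" for v using that r by (auto simp: cmod_w S_def)
  have dw: "(w has_derivative (\<lambda>h. of_real (h $ 1) * exp (\<i> * of_real (v $ 2)) + of_real (h $ 2) * (\<i> * w v))) (at v)" for v
  proof -
    have "((\<lambda>v :: real^2. \<i> * of_real (v $ 2)) has_derivative (\<lambda>h. \<i> * of_real (h $ 2))) (at v)"
      by (intro has_derivative_mult_right bounded_linear.has_derivative[OF bounded_linear_of_real]
          bounded_linear.has_derivative[OF bounded_linear_vec_nth] has_derivative_ident)
    moreover have "(exp has_derivative (*) (exp (\<i> * of_real (v $ 2)))) (at (\<i> * of_real (v $ 2)))"
      using DERIV_exp by (simp add: has_field_derivative_def)
    ultimately have E: "((\<lambda>v. exp (\<i> * of_real (v $ 2))) has_derivative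
        (\<lambda>h. exp (\<i> * of_real (v $ 2)) * (\<i> * of_real (h $ 2)))) (at v)"
      using diff_chain_at by (fastforce simp: o_def)
    have "((\<lambda>v :: real^2. complex_of_real (v $ 1)) has_derivative (\<lambda>h. of_real (h $ 1))) (at v)"
      by (intro bounded_linear.has_derivative[OF bounded_linear_of_real]
          bounded_linear.has_derivative[OF bounded_linear_vec_nth] has_derivative_ident)
    from has_derivative_mult[OF this E] show ?thesis
      unfolding w_def by (rule has_derivative_eq_rhs) (simp add: fun_eq_iff algebra_simps)
  qed
  have dG: "(G has_derivative G' v) (at v)" if "v \<in> S" for v
  proof -
    have "(f has_derivative (\<lambda>h. deriv f (w v) * h)) (at (w v))"
      using holomorphic_derivI[OF hol _ w_in[OF that]] by (simp add: has_field_derivative_def)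
    from diff_chain_at[OF dw this]
    have "((\<lambda>v. f (w v)) has_derivative (\<lambda>h. deriv f (w v) * (of_real (h $ 1) * exp (\<i> * of_real (v $ 2)) + of_real (h $ 2) * (\<i> * w v)))) (at v)"
      by (simp add: o_def)
    from bounded_linear.has_derivative[OF bounded_linear_complex_vec this]
    show ?thesis unfolding G_def[abs_def] G'_def[abs_def] .
  qed
  have detG: "\<bar>det (matrix (G' v))\<bar> = v $ 1 * (cmod (deriv f (w v)))\<^sup>2" if "v \<in> S" for v
  proof -
    \<comment> \<open>The columns of the Jacobian are \<open>a\<close> and \<i> \<rho>
      \<open>a\<close>, orthogonal and of lengths |a| and \<rho> |a|.\<close>
    define a where "a = deriv f (w v) * exp (\<i> * of_real (v $ 2))"
    have 1: "G' v (axis 1 1) = complex_vec a" by (simp add: G'_def a_def axis_def)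
    have 2: "G' v (axis 2 1) = complex_vec (\<i> * of_real (v $ 1) * a)"
      by (simp add: G'_def a_def axis_def w_def algebra_simps)
    have "det (matrix (G' v)) = v $ 1 * ((Re a)\<^sup>2 + (Im a)\<^sup>2)"
      by (simp add: det_2 matrix_def 1 2 algebra_simps power2_eq_square)
    also have "\<dots> = v $ 1 * (cmod (deriv f (w v)))\<^sup>2"
    proof -
      have "cmod a = cmod (deriv f (w v))" by (simp add: a_def norm_mult)
      then show ?thesis using cmod_power2[of a] by simp
    qed
    finally show ?thesis using that by (simp add: S_def)
  qed
  have injG: "inj_on G S"
  proof (rule inj_onI)
    fix u v assume uv: "u \<in> S" "v \<in> S" "G u = G v"
    then have "f (w u) = f (w v)" unfolding G_def by (metis vec_complex_vec)
    then have eq: "w u = w v" using inj w_in uv by (auto dest: inj_onD)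
    have "u $ 1 = v $ 1" using arg_cong[OF eq, of cmod] uv by (simp add: cmod_w S_def)
    moreover have "Arg2pi (w z) = z $ 2" if "z \<in> S" for z
      using that by (intro Arg2pi_unique[of "z $ 1"]) (auto simp: w_def S_def)
    then have "u $ 2 = v $ 2" using eq uv by metis
    ultimately show "u = v" by (simp add: vec_eq_iff forall_2)
  qed
  have contG: "continuous_on S G"
    using dG has_derivative_continuous by (intro continuous_at_imp_continuous_on) blast
  \<comment> \<open>Openness makes the image measurable, so \<open>P\<close> may be integrated over
    it.\<close>
  have GS: "open (G ` S)" by (rule invariance_of_domain[OF contG S_open injG])
  define P where "P v = \<psi> (vec_complex v)" for v
  have P0: "P v \<ge> 0" for v using \<psi>_pos[of "vec_complex v"] by (simp add: P_def)
  have contP: "continuous_on UNIV P"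
  proof -
    have "1 + (t::real)\<^sup>2 \<noteq> 0" for t by (metis add_pos_nonneg less_irrefl zero_le_power2 zero_less_one)
    then show ?thesis unfolding P_def \<psi>_def vec_complex_def by (auto intro!: continuous_intros)
  qed
  then have [measurable]: "P \<in> borel_measurable borel" by (rule borel_measurable_continuous_onI)
  have "integrable lborel P"
    using nn_integral_\<psi>_finite P0 by (intro integrableI_nonneg) (auto simp: P_def)
  then have "P absolutely_integrable_on UNIV"
    by (simp add: set_integrable_def integrable_completion)
  then have absP: "P absolutely_integrable_on (G ` S)"
    by (rule set_integrable_subset) (use GS in auto)
  define b where "b = integral (G ` S) P"
  \<comment> \<open>The change of variables theorem concerns vector-valued integrands, hence the
    passage through \<open>real^1\<close>.\<close>
  have "((\<lambda>v. vec (P v)) :: real^2 \<Rightarrow> real^1) absolutely_integrable_on (G ` S) \<and>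
      integral (G ` S) (\<lambda>v. vec (P v) :: real^1) = vec b"
    using absP unfolding b_def
    by (auto simp: absolutely_integrable_on_1_iff integral_on_1_eq)
  then have "(\<lambda>v. \<bar>det (matrix (G' v))\<bar> *\<^sub>R (vec (P (G v)) :: real^1)) absolutely_integrable_on S \<and>
      integral S (\<lambda>v. \<bar>det (matrix (G' v))\<bar> *\<^sub>R (vec (P (G v)) :: real^1)) = vec b"
    by (subst has_absolute_integral_change_of_variables[OF _ _ injG])
       (use dG S_open in \<open>auto intro: has_derivative_at_withinI\<close>)
  then have J: "(\<lambda>v. \<bar>det (matrix (G' v))\<bar> * P (G v)) absolutely_integrable_on S"
      "integral S (\<lambda>v. \<bar>det (matrix (G' v))\<bar> * P (G v)) = b"
    by (auto simp: absolutely_integrable_on_1_iff integral_on_1_eq vec_eq_iff)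
  define J where "J v = v $ 1 * (cmod (deriv f (w v)))\<^sup>2 * \<psi> (f (w v))" for v
  have JG: "\<bar>det (matrix (G' v))\<bar> * P (G v) = J v" if "v \<in> S" for v
    using detG[OF that] by (simp add: J_def P_def G_def)
  have J0: "J v \<ge> 0" if "v \<in> S" for v
    using that \<psi>_pos[of "f (w v)"] by (auto simp: J_def S_def intro!: mult_nonneg_nonneg)
  have "(J has_integral b) S"
  proof (rule has_integral_eq[OF JG])
    show "((\<lambda>v. \<bar>det (matrix (G' v))\<bar> * P (G v)) has_integral b) S"
      using J by (simp add: has_integral_iff absolutely_integrable_on_def)
  qed
  then have N: "(\<integral>\<^sup>+v. indicator S v * ennreal (J v) \<partial>lborel) = ennreal b"
  proof -
    have "(\<lambda>v. ennreal (indicator S v * J v)) = (\<lambda>v. indicator S v * ennreal (J v))"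
      by (auto simp: indicator_def fun_eq_iff)
    then show ?thesis using nn_integral_has_integral_lebesgue[OF J0 \<open>(J has_integral b) S\<close>] by simp
  qed
  have Nb: "ennreal b \<le> (\<integral>\<^sup>+v. ennreal (P v) \<partial>lborel)"
  proof -
    have "(P has_integral b) (G ` S)"
      using absP by (simp add: b_def absolutely_integrable_on_def has_integral_iff)
    then have "ennreal b = (\<integral>\<^sup>+v. indicator (G ` S) v * P v \<partial>lborel)"
      using nn_integral_has_integral_lebesgue[of "G ` S" P b] P0 by simp
    also have "\<dots> \<le> (\<integral>\<^sup>+v. ennreal (P v) \<partial>lborel)"
      by (intro nn_integral_mono) (auto simp: indicator_def P0)
    finally show ?thesis .
  qed
  \<comment> \<open>Continuity on the open box makes the truncated integrand Borel, as the iterated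
    integral requires.\<close>
  have contJ: "continuous_on S J"
  proof -
    have cw: "continuous_on S w" unfolding w_def by (intro continuous_intros)
    have "continuous_on S (\<lambda>v. deriv f (w v))"
      by (rule continuous_on_compose2[OF holomorphic_on_imp_continuous_on[OF holomorphic_deriv[OF hol open_ball]] cw])
        (use w_in in auto)
    moreover have "continuous_on S (\<lambda>v. f (w v))"
      by (rule continuous_on_compose2[OF holomorphic_on_imp_continuous_on[OF hol] cw]) (use w_in in auto)
    then have "continuous_on S (\<lambda>v. P (complex_vec (f (w v))))"
      by (intro continuous_on_compose2[OF contP] bounded_linear.continuous_on[OF bounded_linear_complex_vec]) auto
    ultimately show ?thesis unfolding J_def P_def vec_complex_vec by (intro continuous_intros)
  qed
  have "(\<lambda>v. indicator S v *\<^sub>R J v) \<in> borel_measurable borel"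
    using contJ S_open by (intro borel_measurable_continuous_on_indicator) auto
  then have meas: "(\<lambda>v. indicator S v * ennreal (J v)) \<in> borel_measurable borel"
  proof -
    assume [measurable]: "(\<lambda>v. indicator S v *\<^sub>R J v) \<in> borel_measurable borel"
    have "(\<lambda>v. ennreal (indicator S v *\<^sub>R J v)) \<in> borel_measurable borel" by measurable
    also have "(\<lambda>v. ennreal (indicator S v *\<^sub>R J v)) = (\<lambda>v. indicator S v * ennreal (J v))"
      by (auto simp: indicator_def fun_eq_iff)
    finally show ?thesis .
  qed
  have F_eq: "?F \<theta> = (\<integral>\<^sup>+\<rho>. indicator S (pair_vec (\<rho>, \<theta>)) * ennreal (J (pair_vec (\<rho>, \<theta>))) \<partial>lborel)" for \<theta>
    by (intro nn_integral_cong) (auto simp: indicator_def S_def J_def w_def cis_conv_exp)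
  have "?I = (\<integral>\<^sup>+v. indicator S v * ennreal (J v) \<partial>lborel)"
    unfolding nn_integral_real_2[OF meas] F_eq ..
  also have "\<dots> \<le> ?\<Psi>" using N Nb by (simp add: P_def)
  finally show "?I \<le> ?\<Psi>" .
  have "(\<lambda>p. indicator S (pair_vec p) * ennreal (J (pair_vec p))) \<in> borel_measurable (lborel \<Otimes>\<^sub>M lborel)"
    using measurable_compose[OF pair_vec_measurable meas] .
  then have "(\<lambda>p. indicator S (pair_vec (snd p, fst p)) * ennreal (J (pair_vec (snd p, fst p)))) \<in> borel_measurable (lborel \<Otimes>\<^sub>M lborel)"
    using measurable_compose[OF measurable_pair_swap'] by (fastforce simp: case_prod_beta)
  then have "(\<lambda>\<theta>. \<integral>\<^sup>+\<rho>. indicator S (pair_vec (\<rho>, \<theta>)) * ennreal (J (pair_vec (\<rho>, \<theta>))) \<partial>lborel) \<in> borel_measurable lborel"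
    by (intro lborel.borel_measurable_nn_integral) (simp add: case_prod_beta)
  then show "?F \<in> borel_measurable borel" unfolding F_eq by simp
qed

section \<open>Radial integration of the derivative of \<open>f ^ k\<close>\<close>

lemma powr_realpow_nat:
  fixes a :: real
  assumes "a \<ge> 0" "k \<ge> 1"
  shows "a powr real k = a ^ k"
  using assms by (cases "a = 0") (auto simp: powr_realpow)

text \<open>With \<open>a\<close> the left side and \<open>s = sqrt (1 - \<rho>)\<close>, the
  arithmetic-geometric mean inequality gives \<open>a \<le> 1 / (2 * s) + s * a\<^sup>2 / 2\<close>.
  For \<open>X = A * (1 - \<rho>) powr (- e)\<close> one has |u| \<le> \<open>X\<close> and 1 /
  \<psi>(u) \<le> 4 X^4, and the choice of \<open>e\<close> makes \<open>s * X ^ (2 * k + 2)\<close>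
  the constant \<open>A ^ (2 * k + 2)\<close>.\<close>

lemma deriv_power_bound:
  fixes k :: nat
  assumes A: "A \<ge> 1" and growth: "cmod u \<le> A * (1 - \<rho>) powr (- e)"
    and e: "e * real (2 * k + 2) = 1 / 2" and k: "k \<ge> 1" and \<rho>: "0 \<le> \<rho>" "\<rho> < 1"
  shows "cmod u ^ (k - 1) * cmod u' \<le> 1 / (2 * sqrt (1 - \<rho>)) + 2 * A ^ (2 * k + 2) * ((cmod u')\<^sup>2 * \<psi> u)"
proof -
  define s where "s = sqrt (1 - \<rho>)"
  define X where "X = A * (1 - \<rho>) powr (- e)"
  have s: "s > 0" using \<rho> by (simp add: s_def)
  have e0: "e > 0"
  proof (rule ccontr)
    assume "\<not> e > 0"
    then have "e * real (2 * k + 2) \<le> 0" by (intro mult_nonpos_nonneg) auto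
    with e show False by simp
  qed
  have "(1 - \<rho>) powr (- e) \<ge> 1"
    using \<rho> e0 powr_mono2'[of "- e" "1 - \<rho>" 1] by simp
  then have X1: "X \<ge> 1" unfolding X_def using A mult_mono[of 1 A 1 "(1 - \<rho>) powr (- e)"] by simp
  have X2: "X\<^sup>2 \<ge> 1" using X1 by simp
  have uX: "cmod u \<le> X" using growth by (simp add: X_def)
  have sq: "(Re u)\<^sup>2 \<le> X\<^sup>2" "(Im u)\<^sup>2 \<le> X\<^sup>2"
    using uX abs_Re_le_cmod[of u] abs_Im_le_cmod[of u] X1 by (auto simp: abs_le_square_iff[symmetric])
  have "X ^ (2 * k + 2) = A ^ (2 * k + 2) * ((1 - \<rho>) powr (- e)) ^ (2 * k + 2)"
    by (simp only: X_def power_mult_distrib)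
  also have "((1 - \<rho>) powr (- e)) ^ (2 * k + 2) = ((1 - \<rho>) powr (- e)) powr real (2 * k + 2)"
    using \<rho> by (subst powr_realpow) simp_all
  also have "\<dots> = (1 - \<rho>) powr (- (e * real (2 * k + 2)))"
    by (simp only: powr_powr mult_minus_left)
  also have "\<dots> = (1 - \<rho>) powr (- (1/2))" unfolding e ..
  also have "\<dots> = 1 / s" using \<rho> by (simp add: powr_minus powr_half_sqrt s_def field_simps)
  finally have Xp: "s * X ^ (2 * k + 2) = A ^ (2 * k + 2)" using s by simp
  define D where "D = (1 + (Re u)\<^sup>2) * (1 + (Im u)\<^sup>2)"
  have D: "D > 0" unfolding D_def by (intro mult_pos_pos add_pos_nonneg) auto
  have \<psi>D: "\<psi> u = 1 / D" by (simp add: \<psi>_def D_def field_simps)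
  have "D \<le> (2 * X\<^sup>2) * (2 * X\<^sup>2)"
    unfolding D_def using sq X2 by (intro mult_mono) auto
  then have "(cmod u ^ (k - 1))\<^sup>2 * D \<le> (X ^ (k - 1))\<^sup>2 * ((2 * X\<^sup>2) * (2 * X\<^sup>2))"
    using uX D by (intro mult_mono power_mono) auto
  also have "\<dots> = 4 * X ^ (2 * k + 2)"
  proof -
    obtain j where "k = Suc j" using k by (cases k) auto
    then show ?thesis by (simp add: power2_eq_square power_mult mult_ac)
  qed
  finally have "s * ((cmod u ^ (k - 1))\<^sup>2 * D) \<le> s * (4 * X ^ (2 * k + 2))" using s by simp
  then have "s * (cmod u ^ (k - 1))\<^sup>2 * D \<le> 4 * A ^ (2 * k + 2)" using Xp by (simp add: mult_ac)
  then have b: "s * (cmod u ^ (k - 1))\<^sup>2 \<le> 4 * A ^ (2 * k + 2) * \<psi> u"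
    using D by (simp add: \<psi>D field_simps)
  define a where "a = cmod u ^ (k - 1) * cmod u'"
  have "0 \<le> (s * a - 1)\<^sup>2 / s" using s by simp
  also have "\<dots> = s * a\<^sup>2 - 2 * a + 1 / s" using s by (simp add: field_simps power2_eq_square)
  finally have "a \<le> 1 / (2 * s) + s * a\<^sup>2 / 2" by (simp add: field_simps)
  also have "s * a\<^sup>2 = s * (cmod u ^ (k - 1))\<^sup>2 * (cmod u')\<^sup>2" by (simp add: a_def power_mult_distrib)
  also have "\<dots> \<le> 4 * A ^ (2 * k + 2) * \<psi> u * (cmod u')\<^sup>2" using b by (intro mult_right_mono) auto
  finally show ?thesis by (simp add: a_def s_def mult_ac)
qed

text \<open>The antiderivative \<open>- sqrt (1 - \<rho>)\<close> stays bounded up to \<rho> = 1, so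
  this majorant contributes a bound independent of \<open>r\<close>.\<close>

lemma has_integral_inverse_sqrt:
  assumes "1/2 \<le> r" "r < (1 :: real)"
  shows "((\<lambda>\<rho>. 1 / (2 * sqrt (1 - \<rho>))) has_integral (sqrt (1/2) - sqrt (1 - r))) {1/2..r}"
proof -
  have "((\<lambda>\<rho>. 1 / (2 * sqrt (1 - \<rho>))) has_integral (- sqrt (1 - r) - (- sqrt (1 - 1/2)))) {1/2..r}"
  proof (rule fundamental_theorem_of_calculus)
    fix t assume "t \<in> {1/2..r}"
    then have "1 - t > 0" using assms by auto
    then have "((\<lambda>\<rho>. - sqrt (1 - \<rho>)) has_real_derivative 1 / (2 * sqrt (1 - t))) (at t within {1/2..r})"
      by (auto intro!: derivative_eq_intros simp: field_simps)
    then show "((\<lambda>\<rho>. - sqrt (1 - \<rho>)) has_vector_derivative 1 / (2 * sqrt (1 - t))) (at t within {1/2..r})"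
      by (simp add: has_real_derivative_iff_has_vector_derivative)
  qed (use assms in auto)
  then show ?thesis by simp
qed

lemma nn_integral_Ioo:
  fixes q :: "real \<Rightarrow> real"
  assumes "continuous_on {a..b} q" "\<And>t. t \<in> {a..b} \<Longrightarrow> q t \<ge> 0"
  shows "(\<integral>\<^sup>+t. indicator {a<..<b} t * ennreal (q t) \<partial>lborel) = ennreal (integral {a..b} q)"
proof -
  have "(q has_integral integral {a..b} q) {a<..<b}"
    using integrable_integral[OF integrable_continuous_interval[OF assms(1)]]
    by (simp add: has_integral_Icc_iff_Ioo)
  from nn_integral_has_integral_lebesgue[OF _ this] assms(2)
  have "(\<integral>\<^sup>+t. ennreal (indicator {a<..<b} t * q t) \<partial>lborel) = ennreal (integral {a..b} q)" by auto
  also have "(\<lambda>t. ennreal (indicator {a<..<b} t * q t)) = (\<lambda>t. indicator {a<..<b} t * ennreal (q t))"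
    by (auto simp: indicator_def fun_eq_iff)
  finally show ?thesis .
qed

text \<open>On each ray \<open>f ^ k\<close> is its value at radius 1/2 plus the integral of its
  radial derivative, estimated by \<open>deriv_power_bound\<close>. Integrating over the angle
  leaves an area integral that \<open>nn_integral_polar_le\<close> bounds independently of
  \<open>r\<close>.\<close>

lemma Hardy_space_of_growth:
  fixes k :: nat
  assumes hol: "f holomorphic_on ball 0 1" and inj: "inj_on f (ball 0 1)"
    and A: "A \<ge> 1" and growth: "\<And>z. z \<in> ball 0 1 \<Longrightarrow> cmod (f z) \<le> A * (1 - cmod z) powr (- e)"
    and e: "e * real (2 * k + 2) = 1 / 2" and k: "k \<ge> 1"
  shows "f \<in> Hardy_space (real k)"
proof -
  have contf: "continuous_on (ball 0 1) f" using hol by (rule holomorphic_on_imp_continuous_on)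
  have contf': "continuous_on (ball 0 1) (deriv f)"
    using hol by (intro holomorphic_on_imp_continuous_on holomorphic_deriv) auto
  \<comment> \<open>Bounds the starting value at radius 1/2 and settles all radii
    \<open>r \<le> 1/2\<close>.\<close>
  obtain K0 where K0: "\<And>z. z \<in> cball 0 (1/2) \<Longrightarrow> cmod (f z) ^ k \<le> K0"
  proof -
    have "compact ((\<lambda>z. cmod (f z) ^ k) ` cball 0 (1/2))"
      by (intro compact_continuous_image continuous_intros continuous_on_subset[OF contf]) auto
    then have "bdd_above ((\<lambda>z. cmod (f z) ^ k) ` cball 0 (1/2))"
      by (intro bounded_imp_bdd_above compact_imp_bounded)
    then obtain M where "\<forall>z\<in>cball 0 (1/2). cmod (f z) ^ k \<le> M" by (auto simp: bdd_above_def)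
    then show ?thesis using that by blast
  qed
  have K0_nonneg: "K0 \<ge> 0"
    using order_trans[OF zero_le_power[OF norm_ge_zero] K0[of 0]] by simp
  \<comment> \<open>The leading 2 comes from \<open>1 \<le> 2 * \<rho>\<close> for \<rho> \<ge> 1/2,
    which inserts the polar weight \<rho> of \<open>Q\<close>; \<open>real k\<close> comes from
    differentiating the power.\<close>
  define B where "B = 2 * real k * (2 * A ^ (2 * k + 2))"
  have B: "B \<ge> 0" using A by (simp add: B_def)
  define Q where "Q \<theta> \<rho> = \<rho> * (cmod (deriv f (of_real \<rho> * cis \<theta>)))\<^sup>2 * \<psi> (f (of_real \<rho> * cis \<theta>))" for \<theta> \<rho>
  have in_ball: "of_real \<rho> * cis \<theta> \<in> ball 0 1" if "\<bar>\<rho>\<bar> < 1" for \<rho> \<theta>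
    using that by (simp add: norm_mult)
  have cont\<psi>: "continuous_on UNIV \<psi>"
  proof -
    have "1 + (t::real)\<^sup>2 \<noteq> 0" for t by (metis add_pos_nonneg less_irrefl zero_le_power2 zero_less_one)
    then show ?thesis unfolding \<psi>_def by (auto intro!: continuous_intros)
  qed
  have contQ: "continuous_on {1/2..r} (Q \<theta>)" if "r < 1" for r \<theta>
    unfolding Q_def
    by (intro continuous_intros continuous_on_compose2[OF contf'] continuous_on_compose2[OF contf]
        continuous_on_compose2[OF cont\<psi>] in_ball) (use that in \<open>auto simp: norm_mult\<close>)
  have radial: "cmod (f (of_real r * cis \<theta>)) ^ k \<le> K0 + real k + B * integral {1/2..r} (Q \<theta>)"
    if r: "1/2 < r" "r < 1" for r \<theta>
  proof -
    define g where "g \<rho> = f (of_real \<rho> * cis \<theta>) ^ k" for \<rho> :: real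
    define g' where "g' \<rho> = of_nat k * f (of_real \<rho> * cis \<theta>) ^ (k - 1) * (deriv f (of_real \<rho> * cis \<theta>) * cis \<theta>)" for \<rho> :: real
    define W where "W \<rho> = real k * (1 / (2 * sqrt (1 - \<rho>))) + B * Q \<theta> \<rho>" for \<rho>
    have FTC: "(g' has_integral g r - g (1/2)) {1/2..r}"
    proof (rule fundamental_theorem_of_calculus)
      fix t assume t: "t \<in> {1/2..r}"
      have "((\<lambda>w. f (w * cis \<theta>)) has_field_derivative deriv f (of_real t * cis \<theta>) * cis \<theta>) (at (of_real t))"
        by (rule DERIV_chain2[where f = f and g = "\<lambda>w. w * cis \<theta>", OF holomorphic_derivI[OF hol open_ball in_ball]])
          (use t r in \<open>auto intro!: derivative_eq_intros\<close>)
      then have "((\<lambda>w. f (w * cis \<theta>) ^ k) has_field_derivative g' t) (at (of_real t))"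
        unfolding g'_def by (auto intro!: derivative_eq_intros)
      then show "(g has_vector_derivative g' t) (at t within {1/2..r})"
        unfolding g_def using has_vector_derivative_real_field has_vector_derivative_at_within by blast
    qed (use r in auto)
    have Wint: "(W has_integral real k * (sqrt (1/2) - sqrt (1 - r)) + B * integral {1/2..r} (Q \<theta>)) {1/2..r}"
      unfolding W_def
      by (intro has_integral_add has_integral_mult_right has_integral_inverse_sqrt integrable_integral
          integrable_continuous_interval contQ) (use r in auto)
    have bound: "cmod (g' t) \<le> W t" if t: "t \<in> {1/2..r}" for t
    proof -
      let ?w = "of_real t * cis \<theta>"
      have cm: "cmod ?w = t" using t by (simp add: norm_mult)
      have wb: "?w \<in> ball 0 1" using t r by (intro in_ball) auto
      have "cmod (g' t) = real k * (cmod (f ?w) ^ (k - 1) * cmod (deriv f ?w))"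
        by (simp add: g'_def norm_mult norm_power)
      also have "\<dots> \<le> real k * (1 / (2 * sqrt (1 - t)) + 2 * A ^ (2 * k + 2) * ((cmod (deriv f ?w))\<^sup>2 * \<psi> (f ?w)))"
        using growth[OF wb] t r by (intro mult_left_mono deriv_power_bound[OF A _ e k]) (auto simp: cm)
      also have "\<dots> \<le> real k * (1 / (2 * sqrt (1 - t)) + 2 * A ^ (2 * k + 2) * (2 * t * ((cmod (deriv f ?w))\<^sup>2 * \<psi> (f ?w))))"
        using t A mult_right_mono[of 1 "2 * t" "(cmod (deriv f ?w))\<^sup>2 * \<psi> (f ?w)"] less_imp_le[OF \<psi>_pos]
        by (intro mult_left_mono add_left_mono) auto
      also have "\<dots> = W t" by (simp add: W_def B_def Q_def algebra_simps)
      finally show ?thesis .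
    qed
    have "cmod (g r - g (1/2)) \<le> integral {1/2..r} W"
      using integral_norm_bound_integral[of g' "{1/2..r}" W] FTC Wint bound by (metis has_integral_iff)
    also have "\<dots> = real k * (sqrt (1/2) - sqrt (1 - r)) + B * integral {1/2..r} (Q \<theta>)"
      using Wint by (rule integral_unique)
    also have "real k * (sqrt (1/2) - sqrt (1 - r)) \<le> real k * 1"
    proof (rule mult_left_mono)
      have "sqrt (1/2) \<le> sqrt (1::real)" by (rule real_sqrt_le_mono) simp
      moreover have "0 \<le> sqrt (1 - r)" using r by simp
      ultimately show "sqrt (1/2) - sqrt (1 - r) \<le> 1" unfolding real_sqrt_one by linarith
    qed simp
    finally have "cmod (g r - g (1/2)) \<le> real k + B * integral {1/2..r} (Q \<theta>)" by simp
    moreover have "cmod (g (1/2)) \<le> K0"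
      using K0[of "of_real (1/2) * cis \<theta>"] by (simp add: g_def norm_power norm_mult)
    moreover have "cmod (g r) \<le> cmod (g (1/2)) + cmod (g r - g (1/2))"
      by (metis norm_triangle_sub)
    ultimately show ?thesis by (simp add: g_def norm_power)
  qed
  obtain I0 where I0: "I0 \<ge> 0" "(\<integral>\<^sup>+v. ennreal (\<psi> (vec_complex v)) \<partial>lborel) = ennreal I0"
    using nn_integral_\<psi>_finite by (metis ennreal_cases infinity_ennreal_def less_irrefl)
  define M where "M = (K0 + real k) * (2 * pi) + B * I0"
  have M: "(K0 + real k) * (2 * pi) \<le> M" using B I0 by (simp add: M_def)
  have cont_circle: "continuous_on T (\<lambda>\<theta>. cmod (f (of_real r * cis \<theta>)) ^ k)" if "0 < r" "r < 1" for r and T :: "real set"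
    by (intro continuous_intros continuous_on_compose2[OF contf]) (use that in \<open>auto simp: norm_mult\<close>)
  have "integral {0..2 * pi} (\<lambda>\<theta>. cmod (f (of_real r * cis \<theta>)) powr real k) \<le> M" if r: "0 < r" "r < 1" for r
  proof -
    let ?q = "\<lambda>\<theta>. cmod (f (of_real r * cis \<theta>)) ^ k"
    have qint: "?q integrable_on {0..2 * pi}"
      by (intro integrable_continuous_interval cont_circle r)
    have "integral {0..2 * pi} ?q \<le> M"
    proof (cases "r \<le> 1/2")
      case True
      have "integral {0..2 * pi} ?q \<le> integral {0..2 * pi} (\<lambda>_. K0)"
        using True r by (intro integral_le qint integrable_const_ivl K0) (auto simp: norm_mult)
      also have "\<dots> = K0 * (2 * pi)" by simp
      also have "\<dots> \<le> (K0 + real k) * (2 * pi)" by (intro mult_right_mono) auto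
      finally show ?thesis using M by simp
    next
      case False
      then have r2: "1/2 < r" by simp
      let ?F = "\<lambda>\<theta>. \<integral>\<^sup>+\<rho>. indicator {0<..<2*pi} \<theta> * (indicator {1/2<..<r} \<rho> * ennreal (Q \<theta> \<rho>)) \<partial>lborel"
      have polar: "(\<integral>\<^sup>+\<theta>. ?F \<theta> \<partial>lborel) \<le> ennreal I0"
        using nn_integral_polar_le(1)[OF hol inj r(2)] unfolding I0(2) Q_def .
      have Fmeas [measurable]: "?F \<in> borel_measurable borel"
        using nn_integral_polar_le(2)[OF hol inj r(2)] unfolding Q_def .
      have Qnn: "Q \<theta> \<rho> \<ge> 0" if "\<rho> \<in> {1/2..r}" for \<theta> \<rho>
        using that less_imp_le[OF \<psi>_pos] by (auto simp: Q_def intro!: mult_nonneg_nonneg)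
      have F_eq: "?F \<theta> = indicator {0<..<2*pi} \<theta> * ennreal (integral {1/2..r} (Q \<theta>))" for \<theta>
        using nn_integral_Ioo[OF contQ[OF r(2)] Qnn, of \<theta>] by (cases "\<theta> \<in> {0<..<2*pi}") auto
      have "ennreal (integral {0..2*pi} ?q) = (\<integral>\<^sup>+\<theta>. indicator {0<..<2*pi} \<theta> * ennreal (?q \<theta>) \<partial>lborel)"
        by (rule nn_integral_Ioo[symmetric]) (auto intro!: cont_circle r)
      also have "\<dots> \<le> (\<integral>\<^sup>+\<theta>. ennreal (K0 + real k) * indicator {0<..<2*pi} \<theta> + ennreal B * ?F \<theta> \<partial>lborel)"
      proof (rule nn_integral_mono)
        fix \<theta> :: real
        have i0: "integral {1/2..r} (Q \<theta>) \<ge> 0" by (rule integral_nonneg) (auto intro!: integrable_continuous_interval contQ r Qnn)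
        have "ennreal (?q \<theta>) \<le> ennreal (K0 + real k + B * integral {1/2..r} (Q \<theta>))"
          using radial[OF r2 r(2)] by (intro ennreal_leI)
        also have "\<dots> = ennreal (K0 + real k) + ennreal B * ennreal (integral {1/2..r} (Q \<theta>))"
          using B i0 K0_nonneg by (simp add: ennreal_plus ennreal_mult)
        finally show "indicator {0<..<2*pi} \<theta> * ennreal (?q \<theta>)
            \<le> ennreal (K0 + real k) * indicator {0<..<2*pi} \<theta> + ennreal B * ?F \<theta>"
          unfolding F_eq by (auto simp: indicator_def)
      qed
      also have "\<dots> = ennreal (K0 + real k) * emeasure lborel {0<..<2*pi} + ennreal B * (\<integral>\<^sup>+\<theta>. ?F \<theta> \<partial>lborel)"
        by (subst nn_integral_add) (simp_all add: nn_integral_cmult nn_integral_cmult_indicator)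
      also have "\<dots> \<le> ennreal (K0 + real k) * ennreal (2 * pi) + ennreal B * ennreal I0"
        using polar by (intro add_mono mult_left_mono) auto
      also have "\<dots> = ennreal M"
        using B I0 K0_nonneg by (simp add: M_def ennreal_mult[symmetric] ennreal_plus[symmetric] del: ennreal_plus)
      finally show ?thesis
        using B I0 K0_nonneg by (subst (asm) ennreal_le_iff) (auto simp: M_def intro!: add_nonneg_nonneg mult_nonneg_nonneg)
    qed
    then show ?thesis using k by (simp add: powr_realpow_nat)
  qed
  then show ?thesis
    unfolding Hardy_space_def using hol by (auto intro!: bdd_aboveI[of _ M])
qed

section \<open>Growth of functions in Hardy spaces\<close>

text \<open>Rescaling to the unit disc with the centre at 0 reduces this to
  \<open>Schwarz_Pick\<close>.\<close>

lemma Schwarz_Pick_at_center: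
  assumes hol: "g holomorphic_on ball w \<delta>" and lt1: "\<And>u. u \<in> ball w \<delta> \<Longrightarrow> cmod (g u) < 1" and \<delta>: "\<delta> > 0"
  shows "cmod (deriv g w) * \<delta> \<le> 1 - (cmod (g w))\<^sup>2"
proof -
  define F where "F = (\<lambda>u. g (w + of_real \<delta> * u))"
  have in_ball: "w + of_real \<delta> * u \<in> ball w \<delta>" if "u \<in> ball 0 1" for u
    using that \<delta> by (simp add: dist_norm norm_mult)
  have "F holomorphic_on ball 0 1"
    unfolding F_def by (intro holomorphic_on_compose_gen[OF _ hol, unfolded o_def] holomorphic_intros)
      (use in_ball in auto)
  then have "cmod (deriv F 0) * (1 - (cmod 0)\<^sup>2) \<le> 1 - (cmod (F 0))\<^sup>2"
    by (rule Schwarz_Pick) (auto simp: F_def intro!: lt1 in_ball[simplified])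
  moreover have "(g has_field_derivative deriv g w) (at (w + of_real \<delta> * 0))"
    using holomorphic_derivI[OF hol open_ball, of w] \<delta> by simp
  then have "(F has_field_derivative deriv g w * of_real \<delta>) (at 0)"
    unfolding F_def by (rule DERIV_chain2) (auto intro!: derivative_eq_intros)
  then have "deriv F 0 = deriv g w * of_real \<delta>" by (rule DERIV_imp_deriv)
  ultimately show ?thesis using \<delta> by (simp add: F_def norm_mult)
qed

lemma continuous_on_circle_powr:
  assumes "continuous_on (ball 0 1) f" "0 < r" "r < 1" "p > (0 :: real)"
  shows "continuous_on T (\<lambda>\<theta>. cmod (f (of_real r * cis \<theta>)) powr p)"
  by (intro continuous_on_powr' continuous_intros continuous_on_compose2[OF assms(1)])
    (use assms in \<open>auto simp: norm_mult\<close>)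

lemma Hardy_space_bound:
  assumes "f \<in> Hardy_space p"
  shows "\<exists>M. \<forall>r\<in>{0<..<1}. integral {0..2 * pi} (\<lambda>\<theta>. cmod (f (of_real r * cis \<theta>)) powr p) \<le> M"
  using assms by (auto simp: Hardy_space_def bdd_above_def)

text \<open>Pointwise \<open>t powr q \<le> 1 + t powr p\<close>: the 1 covers t \<le> 1, the other
  term t > 1.\<close>

lemma Hardy_space_antimono:
  assumes f: "f \<in> Hardy_space p" and q: "0 < q" "q \<le> p"
  shows "f \<in> Hardy_space q"
proof -
  have hol: "f holomorphic_on ball 0 1" using f by (simp add: Hardy_space_def)
  then have cont: "continuous_on (ball 0 1) f" by (rule holomorphic_on_imp_continuous_on)
  from f obtain M where M: "\<And>r. r \<in> {0<..<1} \<Longrightarrow>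
      integral {0..2 * pi} (\<lambda>\<theta>. cmod (f (of_real r * cis \<theta>)) powr p) \<le> M"
    using Hardy_space_bound by blast
  have "integral {0..2 * pi} (\<lambda>\<theta>. cmod (f (of_real r * cis \<theta>)) powr q) \<le> 2 * pi + M"
    if r: "r \<in> {0<..<1}" for r
  proof -
    have "integral {0..2 * pi} (\<lambda>\<theta>. cmod (f (of_real r * cis \<theta>)) powr q)
        \<le> integral {0..2 * pi} (\<lambda>\<theta>. 1 + cmod (f (of_real r * cis \<theta>)) powr p)"
    proof (rule integral_le)
      show "(\<lambda>\<theta>. cmod (f (of_real r * cis \<theta>)) powr q) integrable_on {0..2 * pi}"
        using r q cont by (intro integrable_continuous_interval continuous_on_circle_powr) auto
      show "(\<lambda>\<theta>. 1 + cmod (f (of_real r * cis \<theta>)) powr p) integrable_on {0..2 * pi}"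
        using r q cont
        by (intro integrable_continuous_interval continuous_on_add continuous_on_circle_powr) auto
      show "cmod (f (of_real r * cis \<theta>)) powr q \<le> 1 + cmod (f (of_real r * cis \<theta>)) powr p" for \<theta>
      proof (cases "cmod (f (of_real r * cis \<theta>)) \<le> 1")
        case True
        then have "cmod (f (of_real r * cis \<theta>)) powr q \<le> 1" using q by (simp add: powr_le1)
        then show ?thesis by (simp add: add_increasing2)
      next
        case False
        then have "cmod (f (of_real r * cis \<theta>)) powr q \<le> cmod (f (of_real r * cis \<theta>)) powr p"
          using q by (intro powr_mono) auto
        then show ?thesis by simp
      qed
    qed
    also have "\<dots> = 2 * pi + integral {0..2 * pi} (\<lambda>\<theta>. cmod (f (of_real r * cis \<theta>)) powr p)"
      using r q cont
      by (subst integral_add) (auto intro!: integrable_continuous_interval continuous_on_circle_powr)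
    finally show ?thesis using M[OF r] by simp
  qed
  then show ?thesis using hol unfolding Hardy_space_def by (auto intro!: bdd_aboveI[of _ "2 * pi + M"])
qed

text \<open>Cauchy's formula for \<open>f ^ k\<close> on a circle around \<open>z\<close>: the Hardy
  bound controls the integral of |f|^k over it, and with radius (1 + |z|) / 2 the kernel costs at
  most 2 / (1 - |z|).\<close>

lemma Hardy_space_growth:
  fixes k :: nat
  assumes f: "f \<in> Hardy_space (real k)" and k: "k \<ge> 1"
  shows "\<exists>C>0. \<forall>z\<in>ball 0 1. cmod (f z) ^ k \<le> C / (1 - cmod z)"
proof -
  have hol: "f holomorphic_on ball 0 1" using f by (simp add: Hardy_space_def)
  then have cont: "continuous_on (ball 0 1) f" by (rule holomorphic_on_imp_continuous_on)
  from f obtain M where M: "\<And>r. r \<in> {0<..<1} \<Longrightarrow>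
      integral {0..2 * pi} (\<lambda>\<theta>. cmod (f (of_real r * cis \<theta>)) powr real k) \<le> M"
    using Hardy_space_bound by blast
  show ?thesis
  proof (intro exI[of _ "\<bar>M\<bar> + 1"] conjI ballI)
    fix z :: complex assume z: "z \<in> ball 0 1"
    define r where "r = (1 + cmod z) / 2"
    have r: "cmod z < r" "0 < r" "r < 1" "r - cmod z = (1 - cmod z) / 2"
      using z unfolding r_def by (auto simp: field_simps add_pos_nonneg)
    define F where "F = (\<lambda>w. f w ^ k)"
    define N where "N t = cmod (f (of_real r * cis t)) ^ k" for t
    define H where "H t = F (of_real r * cis t) / (of_real r * cis t - z) * of_real r * \<i> * cis t" for t
    have "F holomorphic_on cball 0 r"
      unfolding F_def using r by (intro holomorphic_intros holomorphic_on_subset[OF hol]) auto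
    then have "((\<lambda>u. F u / (u - z)) has_contour_integral (2 * of_real pi * \<i> * F z)) (circlepath 0 r)"
      using r by (intro Cauchy_integral_circlepath_simple) auto
    then have HI: "(H has_integral (2 * of_real pi * \<i> * F z)) {0..2 * pi}"
      unfolding circlepath_def H_def by (simp add: has_contour_integral_part_circlepath_iff)
    have NI: "N integrable_on {0..2 * pi}"
      unfolding N_def using r
      by (intro integrable_continuous_interval continuous_intros continuous_on_compose2[OF cont]) (auto simp: norm_mult)
    have bound: "cmod (H t) \<le> 1 / (r - cmod z) * N t" for t
    proof -
      have "cmod (of_real r * cis t) - cmod z \<le> cmod (of_real r * cis t - z)"
        by (rule norm_triangle_ineq2)
      then have d: "r - cmod z \<le> cmod (of_real r * cis t - z)" using r by (simp add: norm_mult)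
      have "cmod (H t) = N t * (r / cmod (of_real r * cis t - z))"
        using r by (simp add: H_def N_def F_def norm_mult norm_divide norm_power)
      also have "\<dots> \<le> N t * (1 / (r - cmod z))"
        using r d by (intro mult_left_mono frac_le) (auto simp: N_def)
      finally show ?thesis by (simp add: mult.commute)
    qed
    have "cmod (integral {0..2 * pi} H) \<le> integral {0..2 * pi} (\<lambda>t. 1 / (r - cmod z) * N t)"
      by (intro integral_norm_bound_integral bound has_integral_integrable[OF HI] integrable_on_mult_right NI)
    also have "\<dots> = 1 / (r - cmod z) * integral {0..2 * pi} N" by simp
    also have "\<dots> \<le> 1 / (r - cmod z) * M"
      using r M[of r] k unfolding N_def[abs_def]
      by (intro mult_left_mono) (auto simp: powr_realpow_nat)
    also have "\<dots> = 2 * M / (1 - cmod z)" unfolding r(4) using z by (simp add: field_simps)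
    finally have "2 * pi * cmod (F z) \<le> 2 * M / (1 - cmod z)"
      using HI by (simp add: has_integral_iff norm_mult)
    then have "pi * cmod (F z) \<le> M / (1 - cmod z)" by simp
    moreover have "1 * cmod (F z) \<le> pi * cmod (F z)" using pi_gt3 by (intro mult_right_mono) auto
    ultimately have "cmod (F z) \<le> M / (1 - cmod z)" by simp
    also have "\<dots> \<le> (\<bar>M\<bar> + 1) / (1 - cmod z)" using z by (intro divide_right_mono) auto
    finally show "cmod (f z) ^ k \<le> (\<bar>M\<bar> + 1) / (1 - cmod z)" by (simp add: F_def norm_power)
  qed simp
qed

section \<open>The Hardy number of the comb\<close>

context comb_map
begin

text \<open>The inverse \<open>g\<close> of \<open>f\<close> is followed along the real axis. The
  disc of radius \<open>(1 + d s) / 2\<close> about \<open>s \<ge> 0\<close> lies in the comb, so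
  Schwarz--Pick bounds |g'| and - ln (1 - |g|^2) grows at most as fast as \<open>4 * h\<close>;
  \<open>h_le_S\<close> then turns \<open>h\<close> into \<open>S\<close>.\<close>

lemma preimage_growth:
  "\<exists>C. \<forall>n. \<exists>z\<in>ball 0 1. f z = of_real (x n) \<and> - ln (1 - (cmod z)\<^sup>2) \<le> C + 4 * K * S n"
proof -
  have inj: "inj_on f (ball 0 1)" and img: "f ` ball 0 1 = comb_domain x"
    using f_bij by (auto simp: bij_betw_def)
  from holomorphic_has_inverse[OF f_hol open_ball inj] obtain g where
    g: "g holomorphic_on comb_domain x" "\<And>z. z \<in> ball 0 1 \<Longrightarrow> g (f z) = z"
    unfolding img by metis
  have g_in: "g w \<in> ball 0 1 \<and> f (g w) = w" if "w \<in> comb_domain x" for w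
    using that g(2) img by (metis imageE)
  have real_in: "of_real t \<in> comb_domain x" if "t \<ge> 0" for t :: real
    using that x1_gt by (intro of_real_in_comb) auto
  define \<nu> where "\<nu> t = (cmod (g (of_real t)))\<^sup>2" for t :: real
  define \<Phi> where "\<Phi> t = - ln (1 - \<nu> t) - 4 * h t" for t
  have mono: "\<Phi> t \<le> \<Phi> 0" if "t \<ge> 0" for t
  proof (rule DERIV_nonpos_imp_nonincreasing[where f = \<Phi>, OF that])
    fix s :: real assume s: "0 \<le> s" "s \<le> t"
    define \<delta> where "\<delta> = (1 + d s) / 2"
    have \<delta>: "\<delta> > 0" using d_nonneg[of s] by (simp add: \<delta>_def)
    have sub: "ball (of_real s) \<delta> \<subseteq> comb_domain x"
    proof
      fix w :: complex assume "w \<in> ball (of_real s) \<delta>"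
      then have w: "cmod (w - of_real s) < \<delta>" by (simp add: dist_norm norm_minus_commute)
      have re: "\<bar>Re w - s\<bar> < \<delta>" and im: "\<bar>Im w\<bar> < \<delta>"
        using abs_Re_le_cmod[of "w - of_real s"] abs_Im_le_cmod[of "w - of_real s"] w by simp_all
      \<comment> \<open>The tooth at \<open>x 0 = 0\<close> limits the radius, so the disc cannot
        reach the left edge \<open>- x 1 < - 1\<close>.\<close>
      have "d s \<le> s" using d_le[of s 0] s x0 by simp
      then have "\<delta> \<le> s + 1" using s by (simp add: \<delta>_def)
      then have "Re w > - 1" using re by linarith
      then have "Re w > - x 1" using x1_gt by linarith
      \<comment> \<open>Meeting a tooth line forces \<open>d s < \<delta>\<close>, that is
        \<open>d s < 1\<close>, and hence \<open>\<delta> < 1\<close>: the disc then passes between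
        the tips.\<close>
      moreover have "\<bar>Im w\<bar> < 1" if "Re w = x k" for k
      proof -
        have "d s < \<delta>" using d_le[of s k] re that by (simp add: abs_minus_commute)
        then have "\<delta> < 1" by (simp add: \<delta>_def)
        then show ?thesis using im by linarith
      qed
      ultimately show "w \<in> comb_domain x" by (auto simp: comb_domain_iff)
    qed
    let ?g = "g (of_real s)" and ?g' = "deriv g (of_real s)"
    have lt: "cmod ?g < 1" using g_in[OF real_in[OF s(1)]] by simp
    have pos: "1 - (cmod ?g)\<^sup>2 > 0" using lt by (simp add: power_less_one_iff abs_square_less_1)
    have SP: "cmod ?g' * \<delta> \<le> 1 - (cmod ?g)\<^sup>2"
      using g(1) sub g_in \<delta> by (intro Schwarz_Pick_at_center) (auto intro: holomorphic_on_subset)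
    have "(g has_field_derivative ?g') (at (of_real s))"
      using g(1) open_comb real_in[OF s(1)] by (rule holomorphic_derivI)
    then have V: "((\<lambda>t. g (of_real t)) has_vector_derivative ?g') (at s)"
      by (rule has_vector_derivative_real_field)
    define q where "q = 2 * (Re ?g * Re ?g' + Im ?g * Im ?g')"
    have Q: "(\<nu> has_real_derivative q) (at s)"
      unfolding \<nu>_def cmod_power2 q_def by (auto intro!: derivative_eq_intros V simp: algebra_simps)
    have "s > - x 1" using s x1_gt by linarith
    have D: "(\<Phi> has_real_derivative (q / (1 - \<nu> s) - 4 * (1 / (1 + d s)))) (at s)"
      unfolding \<Phi>_def using pos[folded \<nu>_def]
      by (auto intro!: derivative_eq_intros Q h_deriv[OF \<open>s > - x 1\<close>])
    have "q = 2 * Re (cnj ?g * ?g')" by (simp add: q_def)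
    also have "\<dots> \<le> 2 * (cmod ?g * cmod ?g')"
      using complex_Re_le_cmod[of "cnj ?g * ?g'"] by (simp add: norm_mult)
    also have "\<dots> \<le> 2 * (1 * cmod ?g')" using lt by (intro mult_left_mono mult_right_mono) auto
    also have "\<dots> \<le> 2 * ((1 - (cmod ?g)\<^sup>2) / \<delta>)" using SP \<delta> by (simp add: field_simps)
    finally have "q / (1 - (cmod ?g)\<^sup>2) \<le> 2 / \<delta>" using pos \<delta> by (simp add: field_simps)
    also have "2 / \<delta> = 4 * (1 / (1 + d s))" by (simp add: \<delta>_def)
    finally have "q / (1 - (cmod ?g)\<^sup>2) - 4 * (1 / (1 + d s)) \<le> 0" by simp
    with D[unfolded \<nu>_def] show "\<exists>y. (\<Phi> has_real_derivative y) (at s) \<and> y \<le> 0" by blast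
  qed
  show ?thesis
  proof (intro exI[of _ "- ln (1 - (cmod (g 0))\<^sup>2)"] allI)
    fix n
    have "- ln (1 - (cmod (g (of_real (x n))))\<^sup>2) \<le> - ln (1 - (cmod (g 0))\<^sup>2) + 4 * (h (x n) - h 0)"
      using mono[OF x_nonneg[of n]] by (simp add: \<Phi>_def \<nu>_def)
    also have "\<dots> \<le> - ln (1 - (cmod (g 0))\<^sup>2) + 4 * K * S n" using h_le_S[of n] by simp
    finally show "\<exists>z\<in>ball 0 1. f z = of_real (x n) \<and>
        - ln (1 - (cmod z)\<^sup>2) \<le> - ln (1 - (cmod (g 0))\<^sup>2) + 4 * K * S n"
      using g_in[OF real_in[OF x_nonneg[of n]]] by blast
  qed
qed

text \<open>The logarithm of the Hardy growth bound at the preimage of \<open>x n\<close>; passing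
  from 1 - |z| to 1 - |z|^2 costs a factor 2.\<close>

lemma ln_x_le:
  fixes k :: nat
  assumes f: "f \<in> Hardy_space (real k)" and k: "k \<ge> 1"
  shows "\<exists>C. \<forall>n\<ge>1. real k * ln (x n) \<le> C + 4 * K * S n"
proof -
  obtain C where C: "C > 0" "\<And>z. z \<in> ball 0 1 \<Longrightarrow> cmod (f z) ^ k \<le> C / (1 - cmod z)"
    using Hardy_space_growth[OF f k] by blast
  obtain B where B: "\<And>n. \<exists>z\<in>ball 0 1. f z = of_real (x n) \<and> - ln (1 - (cmod z)\<^sup>2) \<le> B + 4 * K * S n"
    using preimage_growth by blast
  have "real k * ln (x n) \<le> (ln (2 * C) + B) + 4 * K * S n" if n: "n \<ge> 1" for n
  proof -
    obtain z where z: "z \<in> ball 0 1" "f z = of_real (x n)" "- ln (1 - (cmod z)\<^sup>2) \<le> B + 4 * K * S n"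
      using B by blast
    have xn: "x n > 1" using x_mono[of 1 n] n x1_gt by simp
    have pos: "1 - cmod z > 0" "1 - (cmod z)\<^sup>2 > 0"
      using z(1) by (auto simp: power_less_one_iff abs_square_less_1)
    have "1 - (cmod z)\<^sup>2 = (1 - cmod z) * (1 + cmod z)" by (simp add: power2_eq_square algebra_simps)
    also have "\<dots> \<le> (1 - cmod z) * 2" using z(1) by (intro mult_left_mono) auto
    finally have "2 * C / (2 * (1 - cmod z)) \<le> 2 * C / (1 - (cmod z)\<^sup>2)"
      using C pos by (intro divide_left_mono) auto
    then have "C / (1 - cmod z) \<le> 2 * C / (1 - (cmod z)\<^sup>2)"
      by (subst (asm) mult_divide_mult_cancel_left) auto
    with C(2)[OF z(1)] z(2) xn have "x n ^ k \<le> 2 * C / (1 - (cmod z)\<^sup>2)" by simp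
    then have "ln (x n ^ k) \<le> ln (2 * C / (1 - (cmod z)\<^sup>2))"
      using xn C pos by (subst ln_le_cancel_iff) auto
    also have "\<dots> = ln (2 * C) - ln (1 - (cmod z)\<^sup>2)" using C pos by (subst ln_div) auto
    finally show ?thesis using z(3) xn by (simp add: ln_realpow)
  qed
  then show ?thesis by blast
qed

end

section \<open>The equivalence of infinite Hardy number and divergence of the quotient\<close>

context comb
begin

lemma S_nonneg: "S n \<ge> 0"
  unfolding S_def
proof (rule sum_nonneg)
  fix i assume "i \<in> {1..n}"
  then have "x (i - 1) + c \<le> x i" by (intro x_gap) auto
  then show "ln (x i - x (i - 1)) \<ge> 0" using c_gt by simp
qed

lemma ln_x_at_top: "filterlim (\<lambda>n. ln (x n)) at_top sequentially"
proof (rule filterlim_compose[OF ln_at_top])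
  show "filterlim x at_top sequentially"
    using filterlim_at_top_mono[OF filterlim_real_sequentially] x_ge by (simp add: eventually_sequentially)
qed

text \<open>Integer exponents suffice: an infinite supremum provides exponents beyond any
  \<open>k\<close>, hence \<open>k\<close> itself by \<open>Hardy_space_antimono\<close>, and
  conversely the integers alone make the supremum infinite.\<close>

lemma hardy_number_infinite_iff:
  "hardy_number (comb_domain x) = \<infinity> \<longleftrightarrow> filterlim (\<lambda>n. S n / ln (x n)) at_top sequentially"
proof -
  define f where "f = (SOME f. Riemann_map f (comb_domain x))"
  have "Riemann_map f (comb_domain x)"
    unfolding f_def by (rule someI_ex[of "\<lambda>f. Riemann_map f (comb_domain x)", OF Riemann_map_comb_exists])
  then interpret comb_map x c f by unfold_locales
  define P where "P = {p. p > 0 \<and> f \<in> Hardy_space p}"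
  have number: "hardy_number (comb_domain x) = Sup (ereal ` P)"
    by (simp add: hardy_number_def f_def P_def)
  have ln_pos: "ln (x n) > 0" if "n \<ge> 1" for n
    using x_mono[of 1 n] that x1_gt by simp
  show ?thesis
  proof
    assume inf: "hardy_number (comb_domain x) = \<infinity>"
    have Hk: "f \<in> Hardy_space (real k)" if k: "k \<ge> 1" for k :: nat
    proof -
      have "ereal (real k) < Sup (ereal ` P)" using inf number by simp
      then obtain y where "y \<in> ereal ` P" "ereal (real k) < y" unfolding less_Sup_iff by blast
      then obtain p where p: "p \<in> P" "real k < p" by auto
      show ?thesis
        by (rule Hardy_space_antimono[of f p]) (use p k in \<open>simp_all add: P_def\<close>)
    qed
    show "filterlim (\<lambda>n. S n / ln (x n)) at_top sequentially"
      unfolding filterlim_at_top_gt[where c = 0]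
    proof (intro allI impI)
      fix Z :: real assume Z: "0 < Z"
      \<comment> \<open>Half of \<open>8 * K * Z * ln (x n)\<close> swallows the constant
        \<open>C\<close> once \<open>ln (x n)\<close> is large; the other half gives the bound after
        division by \<open>4 * K\<close>.\<close>
      obtain k where k: "8 * K * Z < real k" using reals_Archimedean2 by blast
      have "8 * K * Z > 0" using K_pos Z by simp
      then have k1: "k \<ge> 1" using k by (cases k) auto
      obtain C where C: "\<And>n. n \<ge> 1 \<Longrightarrow> real k * ln (x n) \<le> C + 4 * K * S n"
        using ln_x_le[OF Hk[OF k1] k1] by blast
      have "eventually (\<lambda>n. ln (x n) \<ge> \<bar>C\<bar> / (4 * K * Z)) sequentially"
        using ln_x_at_top by (simp add: filterlim_at_top)
      then show "eventually (\<lambda>n. Z \<le> S n / ln (x n)) sequentially"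
        using eventually_ge_at_top[of 1]
      proof eventually_elim
        case (elim n)
        have l: "ln (x n) > 0" using elim(2) by (rule ln_pos)
        have "\<bar>C\<bar> \<le> 4 * K * Z * ln (x n)" using elim(1) K_pos Z by (simp add: field_simps)
        moreover have "8 * K * Z * ln (x n) \<le> real k * ln (x n)" using k l by (intro mult_right_mono) auto
        ultimately have "4 * K * (Z * ln (x n)) \<le> 4 * K * S n" using C[OF elim(2)] by (simp add: algebra_simps)
        then have "Z * ln (x n) \<le> S n" using K_pos by simp
        then show ?case using l by (simp add: field_simps)
      qed
    qed
  next
    assume lim: "filterlim (\<lambda>n. S n / ln (x n)) at_top sequentially"
    have cond: "\<exists>B. \<forall>n\<ge>1. ln (x n) \<le> e * S (n - 1) + B" if e: "e > 0" for e
    proof -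
      \<comment> \<open>The extra 1 pays for the last term of \<open>S n\<close>, which is at most
        \<open>ln (x n)\<close>; this moves the bound from \<open>S n\<close> to
        \<open>S (n - 1)\<close>, as \<open>growth\<close> requires.\<close>
      have "eventually (\<lambda>n. S n / ln (x n) \<ge> 1 + 1 / e) sequentially"
        using lim by (simp add: filterlim_at_top)
      then obtain N where N: "\<And>n. n \<ge> N \<Longrightarrow> S n / ln (x n) \<ge> 1 + 1 / e"
        by (auto simp: eventually_sequentially)
      have nonneg: "0 \<le> ln (x i)" if "i \<in> {1..N}" for i
        using that ln_pos[of i] by simp
      \<comment> \<open>The finitely many indices up to \<open>N\<close> are absorbed into the
        additive constant.\<close>
      have "ln (x n) \<le> e * S (n - 1) + (\<Sum>i=1..N. ln (x i))" if n: "n \<ge> 1" for n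
      proof (cases "n \<le> N")
        case True
        have "ln (x n) \<le> (\<Sum>i=1..N. ln (x i))"
          by (rule member_le_sum) (use True n nonneg in auto)
        moreover have "0 \<le> e * S (n - 1)" using e S_nonneg by simp
        ultimately show ?thesis by simp
      next
        case False
        then have "(1 + 1 / e) * ln (x n) \<le> S n" using N[of n] ln_pos[OF n] by (simp add: field_simps)
        also have "S n = S (n - 1) + ln (x n - x (n - 1))" using S_Suc[of "n - 1"] n by simp
        also have "ln (x n - x (n - 1)) \<le> ln (x n)"
          using x_nonneg[of "n - 1"] x_gap[of "n - 1" n] n c_gt by simp
        finally have "ln (x n) / e \<le> S (n - 1)" by (simp add: algebra_simps)
        then have "ln (x n) \<le> e * S (n - 1)" using e by (simp add: field_simps)
        moreover have "0 \<le> (\<Sum>i=1..N. ln (x i))" using nonneg by (rule sum_nonneg)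
        ultimately show ?thesis by simp
      qed
      then show ?thesis by blast
    qed
    have Hk: "f \<in> Hardy_space (real k)" if k: "k \<ge> 1" for k :: nat
    proof -
      \<comment> \<open>The exponent prescribed by \<open>deriv_power_bound\<close>: the power
        \<open>2 * k + 2\<close> of \<open>(1 - \<rho>) powr (- e)\<close> is
        \<open>1 / sqrt (1 - \<rho>)\<close>.\<close>
      define e where "e = 1 / (2 * real (2 * k + 2))"
      have e: "e > 0" "e * real (2 * k + 2) = 1 / 2" by (simp_all add: e_def field_simps)
      obtain A where A: "A > 0" "\<And>z. z \<in> ball 0 1 \<Longrightarrow> cmod (f z) \<le> A * (1 - cmod z) powr (- e)"
        using growth[OF cond e(1)] by blast
      have "cmod (f z) \<le> max A 1 * (1 - cmod z) powr (- e)" if "z \<in> ball 0 1" for z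
        using A(2)[OF that] mult_right_mono[of A "max A 1" "(1 - cmod z) powr (- e)"] by simp
      then show ?thesis
        using f_hol f_bij e(2) k by (intro Hardy_space_of_growth[where A = "max A 1" and e = e]) (auto simp: bij_betw_def)
    qed
    have "Sup (ereal ` P) = \<infinity>"
    proof (rule ereal_top)
      fix B :: real
      obtain k where k: "max B 1 < real k" using reals_Archimedean2 by blast
      then have "real k \<in> P" using Hk[of k] by (auto simp: P_def)
      then have "ereal (real k) \<le> Sup (ereal ` P)" by (intro Sup_upper) auto
      then show "ereal B \<le> Sup (ereal ` P)" using k by (elim order_trans[rotated]) auto
    qed
    then show "hardy_number (comb_domain x) = \<infinity>" by (simp add: number)
  qed
qed

end

theorem theorem1p1:
  fixes x \<alpha> :: "nat \<Rightarrow> real"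
  assumes "x 0 = 0"
    and "strict_mono_on {1..} x"
    and "\<And>n. n \<ge> 1 \<Longrightarrow> x n > 0"
    and "filterlim x at_top sequentially"
    and "(INF n\<in>{1..}. x n - x (n - 1)) > 1"
    and "\<And>n. n \<ge> 1 \<Longrightarrow> \<alpha> n = x n - x (n - 1)"
  shows "(hardy_number (comb_domain x) = \<infinity> \<longleftrightarrow>
            filterlim (\<lambda>n. (\<Sum>i=1..n. ln (\<alpha> i)) / ln (x n)) at_top sequentially) \<and>
         (filterlim (\<lambda>n. (\<Sum>i=1..n. ln (\<alpha> i)) / ln (x n)) at_top sequentially \<longleftrightarrow>
            filterlim (\<lambda>n. (\<Sum>i=1..n. ln (\<alpha> i)) / ln (\<Sum>i=1..n. \<alpha> i)) at_top sequentially)"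
proof -
  define c where "c = (INF n\<in>{1..}. x n - x (n - 1))"
  have nonneg: "0 \<le> x n - x (n - 1)" if "n \<ge> 1" for n
  \<comment> \<open>Monotonicity is given only from index 1 on, so the first gap uses
    \<open>x 0 = 0 < x 1\<close>.\<close>
  proof (cases "n = 1")
    case True
    then show ?thesis using assms(1) assms(3)[of 1] by simp
  next
    case False
    then have "x (n - 1) < x n" using that by (intro strict_mono_onD[OF assms(2)]) auto
    then show ?thesis by simp
  qed
  have "c \<le> x (Suc n) - x n" for n
  proof -
    \<comment> \<open>A real \<open>INF\<close> is a lower bound only for a family bounded below,
      which nonnegative gaps provide.\<close>
    have "bdd_below ((\<lambda>n. x n - x (n - 1)) ` {1..})" using nonneg by (intro bdd_belowI2[of _ 0]) auto
    from cINF_lower[OF this, of "Suc n"] show ?thesis by (simp add: c_def)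
  qed
  then interpret comb x c using assms(1,5) by unfold_locales (auto simp: c_def)
  have S_eq: "(\<Sum>i=1..n. ln (\<alpha> i)) = S n" for n
    unfolding S_def by (intro sum.cong) (auto simp: assms(6))
  \<comment> \<open>The gaps telescope from \<open>x 0 = 0\<close>, so both quotients are the same
    sequence.\<close>
  have x_eq: "(\<Sum>i=1..n. \<alpha> i) = x n" for n
    by (induction n) (auto simp: x0 assms(6))
  show ?thesis unfolding S_eq x_eq using hardy_number_infinite_iff by simp
qed

end
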